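(* Let $k\ge 2$ and $d\ge 1$ be integers. Suppose that $A\subset \mathbb{R}^d$ is a measurable set such that the large-distance graph $\mathcal{G}_A$ is essentially $K_k$-free. Then \[ e(\mathcal{G}_A) \leq \frac{1}{2}\cdot\left( 1- \frac{1}{k-1} \right) \cdot \lambda_d(A)^2 . \] Moreover, the inequality becomes an equality if and only if there exists $c\in [0,\omega_d]$ such that $A$ is a disjoint union of a set of $\lambda_d$-measure zero and $k-1$ disjoint sets $A_1,\ldots,A_{k-1}$ whose pairwise distances are at least $2$ and which satisfy $\operatorname{diam}(A_i)\le 2$ and $\lambda_d(A_i)=c$ for all $i=1,\ldots,k-1$.
   Context: $\lambda_m$ denotes $m$-dimensional Lebesgue measure, $\|\cdot\|$ is the Euclidean norm, and $\omega_d=\pi^{d/2}/\Gamma(d/2+1)$ is the $\lambda_d$-measure of a ball of radius $1$ in $\mathbb{R}^d$. The distance between sets $A,B\subset\mathbb{R}^d$ is $\operatorname{dist}(A,B)=\inf\{\|a-b\| : a\in A,\ b\in B\}$. For a measurable set $A\subset\mathbb{R}^d$, the large-distance graph $\mathcal{G}_A$ has vertex set $A$ and edge set $\mathcal{E}_A=\{(p,q)\in A\times A : \|p-q\|>2\}$. Its "number of edges" is $e(\mathcal{G}_A):=\frac12\lambda_{2d}(\mathcal{E}_A)$. For $k\ge 2$ let $\mathcal{G}_A\langle K_k\rangle\subset A^k$ be the set of all $k$-tuples $(p_1,\ldots,p_k)$ of points in $A$ with $(p_i,p_j)\in\mathcal{E}_A$ (i.e. $\|p_i-p_j\|>2$)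 for all $i\ne j$. The graph $\mathcal{G}_A$ is essentially $K_k$-free if $\lambda_{kd}(\mathcal{G}_A\langle K_k\rangle)=0$. *)

theory Defs
  imports "HOL-Analysis.Analysis"
begin

definition large_distance_edges :: "(real ^ 'n) set \<Rightarrow> ((real ^ 'n) \<times> (real ^ 'n)) set" where
  "large_distance_edges A = {(p, q) \<in> A \<times> A. norm (p - q) > 2}"

definition large_distance_edge_number :: "(real ^ 'n) set \<Rightarrow> ennreal" where
  "large_distance_edge_number A = emeasure lebesgue (large_distance_edges A) / 2"

text \<open>A \<open>k\<close>-tuple of points is an extensional function on \<open>{1..k}\<close>.\<close>

definition large_distance_cliques :: "nat \<Rightarrow> (real ^ 'n) set \<Rightarrow> (nat \<Rightarrow> real ^ 'n) set" where
  "large_distance_cliques k A =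
     {p \<in> {1..k} \<rightarrow>\<^sub>E A. \<forall>i\<in>{1..k}. \<forall>j\<in>{1..k}. i \<noteq> j \<longrightarrow> (p i, p j) \<in> large_distance_edges A}"

text \<open>The completion of the \<open>k\<close>-fold product of Lebesgue-Borel measure on \<open>\<real>\<^sup>d\<close> is
  \<open>kd\<close>-dimensional Lebesgue measure on \<open>(\<real>\<^sup>d)\<^sup>k\<close>.\<close>

definition essentially_clique_free :: "nat \<Rightarrow> (real ^ 'n) set \<Rightarrow> bool" where
  "essentially_clique_free k A \<longleftrightarrow>
     large_distance_cliques k A \<in> null_sets (completion (Pi\<^sub>M {1..k} (\<lambda>_. lborel)))"

text \<open>The distance is extended-real valued, so that it is \<open>\<infinity>\<close> (the infimum of the empty set)
  if one of the sets is empty; the library's \<^const>\<open>setdist\<close> is \<open>0\<close> in that case.\<close>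

definition set_distance :: "(real ^ 'n) set \<Rightarrow> (real ^ 'n) set \<Rightarrow> ereal" where
  "set_distance A B = (INF (a, b) \<in> A \<times> B. ereal (norm (a - b)))"

text \<open>Boundedness is required separately in \<open>diam \<le> 2\<close>, because the real-valued
  \<^const>\<open>diameter\<close> is unspecified for unbounded sets.\<close>

definition extremal_decomposition :: "nat \<Rightarrow> (real ^ 'n) set \<Rightarrow> real \<Rightarrow> bool" where
  "extremal_decomposition k A c \<longleftrightarrow>
     (\<exists>N (B :: nat \<Rightarrow> (real ^ 'n) set). N \<in> null_sets lebesgue \<and>
        A = N \<union> (\<Union>i\<in>{1..k-1}. B i) \<and>
        N \<inter> (\<Union>i\<in>{1..k-1}. B i) = {} \<and>
        disjoint_family_on B {1..k-1} \<and>
        (\<forall>i\<in>{1..k-1}. \<forall>j\<in>{1..k-1}. i \<noteq> j \<longrightarrow> set_distance (B i) (B j) \<ge> 2) \<and>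
        (\<forall>i\<in>{1..k-1}. bounded (B i) \<and> diameter (B i) \<le> 2 \<and>
           B i \<in> sets lebesgue \<and> emeasure lebesgue (B i) = ennreal c))"

end

theory Submission
  imports Defs
begin

text \<open>
  Why the theorem holds. Discarding a null set from \<open>A\<close>, one may assume that \<open>A\<close> is Borel and that
  every ball about a point of \<open>A\<close> meets \<open>A\<close> in positive measure. Then the large-distance graph on
  \<open>A\<close> contains no \<open>k\<close>-clique at all, since a single clique could be thickened to a set of cliques
  of positive measure (\<open>essentially_clique_free_ess_support\<close>). In particular \<open>A\<close> is bounded.

  The inequality is Turan's theorem for \<open>m = k - 1\<close> parts, proved as for finite graphs by induction on
  \<open>m\<close> via a vertex of maximal degree (\<open>turan_far\<close>). Such a vertex exists on the closure of \<open>A\<close>, because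
  the closure is compact and still clique-free, and the degree is a continuous function, spheres being
  null. Following the equality through the induction shows that an extremal \<open>A\<close> splits into \<open>m\<close> parts of equal
  measure such that almost no pair inside a part, and almost every pair across two parts, is an edge.
  Restricting each part to the points about which it has positive measure turns this into
  \<open>diam \<le> 2\<close> for the parts and distance \<open>\<ge> 2\<close> between them. Conversely, such a
  decomposition has the right number of edges, as pairs at distance exactly \<open>2\<close> form a null set.

  The bound \<open>c \<le> \<omega>\<^sub>d\<close> on the measure of the parts is the isodiametric inequality
  (\<open>isodiametric\<close>), proved by Steiner symmetrization in the coordinate directions.
\<close>

section \<open>The isodiametric inequality\<close>

text \<open>The reflection of \<open>x\<close> in the hyperplane orthogonal to the unit vector \<open>b\<close>.\<close>

definition reflect :: "'a::euclidean_space \<Rightarrow> 'a \<Rightarrow> 'a" where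
  "reflect b x = x - (2 * (x \<bullet> b)) *\<^sub>R b"

text \<open>The length of the intersection of \<open>A\<close> with the line through \<open>x\<close> in direction \<open>b\<close>.\<close>

definition slice_length :: "'a::euclidean_space \<Rightarrow> 'a set \<Rightarrow> 'a \<Rightarrow> ennreal" where
  "slice_length b A x = emeasure lborel {t::real. x + t *\<^sub>R b \<in> A}"

text \<open>Steiner symmetrization of \<open>A\<close> in direction \<open>b\<close>: every line parallel to \<open>b\<close> meets the result in
  the open interval, centred on the hyperplane orthogonal to \<open>b\<close>, whose length is that of the
  slice of \<open>A\<close>. The strict inequality makes the symmetrization of a null slice empty, so that a
  point of \<open>steiner b A\<close> always lies on a line that meets \<open>A\<close>; it also keeps Borel sets Borel,
  whereas with \<open>\<le>\<close> one would need the projection of \<open>A\<close> to exclude the empty slices.\<close>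

definition steiner :: "'a::euclidean_space \<Rightarrow> 'a set \<Rightarrow> 'a set" where
  "steiner b A = {x. ennreal (2 * \<bar>x \<bullet> b\<bar>) < slice_length b A x}"

lemma slice_length_eq_nn_integral:
  assumes "A \<in> sets borel"
  shows "slice_length b A x = (\<integral>\<^sup>+t. indicator A (x + t *\<^sub>R b) \<partial>lborel)"
proof -
  have m: "{t::real. x + t *\<^sub>R b \<in> A} \<in> sets lborel"
    using assms by measurable
  have "slice_length b A x = (\<integral>\<^sup>+t. indicator {t::real. x + t *\<^sub>R b \<in> A} t \<partial>lborel)"
    unfolding slice_length_def using m by simp
  also have "\<dots> = (\<integral>\<^sup>+t. indicator A (x + t *\<^sub>R b) \<partial>lborel)"
    by (intro nn_integral_cong) (auto simp: indicator_def)
  finally show ?thesis .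
qed

lemma slice_length_measurable [measurable]:
  assumes [measurable]: "A \<in> sets borel"
  shows "slice_length b A \<in> borel_measurable borel"
proof -
  have "(\<lambda>x. \<integral>\<^sup>+t. indicator A (x + t *\<^sub>R b) \<partial>lborel) \<in> borel_measurable borel"
    by measurable
  then show ?thesis
    by (simp add: slice_length_eq_nn_integral[OF assms, abs_def] cong: measurable_cong)
qed

lemma steiner_borel [measurable]:
  assumes [measurable]: "A \<in> sets borel"
  shows "steiner b A \<in> sets borel"
  unfolding steiner_def by measurable

lemma slice_length_shift:
  assumes "A \<in> sets borel"
  shows "slice_length b A (x + s *\<^sub>R b) = slice_length b A x"
proof -
  have [measurable]: "(\<lambda>t::real. indicator A (x + t *\<^sub>R b) :: ennreal) \<in> borel_measurable borel"
    using assms by measurable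
  have "slice_length b A x = (\<integral>\<^sup>+t. indicator A (x + t *\<^sub>R b) \<partial>lborel)"
    by (rule slice_length_eq_nn_integral[OF assms])
  also have "\<dots> = (\<integral>\<^sup>+t. indicator A (x + t *\<^sub>R b) \<partial>(distr lborel borel ((+) s)))"
    by (simp add: lborel_distr_plus)
  also have "\<dots> = (\<integral>\<^sup>+t. indicator A (x + (s + t) *\<^sub>R b) \<partial>lborel)"
    by (subst nn_integral_distr) auto
  also have "\<dots> = slice_length b A (x + s *\<^sub>R b)"
    by (subst slice_length_eq_nn_integral[OF assms]) (simp add: algebra_simps)
  finally show ?thesis by simp
qed

text \<open>A form of Fubini's theorem that avoids splitting the space into the line through \<open>b\<close> and its
  orthogonal complement: integrating the slice length over all of the slab
  \<open>0 \<le> x \<bullet> b \<le> 1\<close>, which has width one, counts every slice exactly once. It shows that the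
  measure of \<open>A\<close> depends only on its slice lengths.\<close>

lemma emeasure_eq_slices:
  fixes A :: "'a::euclidean_space set"
  assumes A [measurable]: "A \<in> sets borel" and b: "b \<in> Basis"
  shows "emeasure lborel A
     = (\<integral>\<^sup>+x. indicator {0..1} (x \<bullet> b) * slice_length b A x \<partial>lborel)"
proof -
  let ?w = "indicator {0..1::real} :: real \<Rightarrow> ennreal"
  have w: "(\<integral>\<^sup>+t. ?w (c - t) \<partial>lborel) = 1" for c :: real
  proof -
    have "(\<integral>\<^sup>+t. ?w (c - t) \<partial>lborel) = (\<integral>\<^sup>+t. indicator {c-1..c} t \<partial>lborel)"
      by (intro nn_integral_cong) (auto simp: indicator_def)
    then show ?thesis by simp
  qed
  \<comment> \<open>The weight of total mass one is inserted, the order of integration exchanged,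
    and \<open>x\<close> shifted by \<open>t *\<^sub>R b\<close>.\<close>
  have "emeasure lborel A = (\<integral>\<^sup>+x. indicator A x * (\<integral>\<^sup>+t. ?w (x \<bullet> b - t) \<partial>lborel) \<partial>lborel)"
    unfolding w by simp
  also have "\<dots> = (\<integral>\<^sup>+x. (\<integral>\<^sup>+t. indicator A x * ?w (x \<bullet> b - t) \<partial>lborel) \<partial>lborel)"
    by (rule nn_integral_cong, rule nn_integral_cmult[symmetric]) measurable
  also have "\<dots> = (\<integral>\<^sup>+t. (\<integral>\<^sup>+x. indicator A x * ?w (x \<bullet> b - t) \<partial>lborel) \<partial>lborel)"
    by (rule lborel_pair.Fubini'[symmetric]) measurable
  also have "\<dots> = (\<integral>\<^sup>+t. (\<integral>\<^sup>+x. indicator A (x + t *\<^sub>R b) * ?w (x \<bullet> b) \<partial>lborel) \<partial>lborel)"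
  proof (rule nn_integral_cong)
    fix t :: real
    have "(\<integral>\<^sup>+x. indicator A x * ?w (x \<bullet> b - t) \<partial>lborel)
        = (\<integral>\<^sup>+x. indicator A x * ?w (x \<bullet> b - t) \<partial>(distr lborel borel ((+) (t *\<^sub>R b))))"
      by (simp add: lborel_distr_plus)
    also have "\<dots> = (\<integral>\<^sup>+x. indicator A (t *\<^sub>R b + x) * ?w ((t *\<^sub>R b + x) \<bullet> b - t) \<partial>lborel)"
      by (subst nn_integral_distr) measurable
    also have "\<dots> = (\<integral>\<^sup>+x. indicator A (x + t *\<^sub>R b) * ?w (x \<bullet> b) \<partial>lborel)"
      using b by (intro nn_integral_cong) (simp add: inner_simps add.commute)
    finally show "(\<integral>\<^sup>+x. indicator A x * ?w (x \<bullet> b - t) \<partial>lborel)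
        = (\<integral>\<^sup>+x. indicator A (x + t *\<^sub>R b) * ?w (x \<bullet> b) \<partial>lborel)" .
  qed
  also have "\<dots> = (\<integral>\<^sup>+x. (\<integral>\<^sup>+t. indicator A (x + t *\<^sub>R b) * ?w (x \<bullet> b) \<partial>lborel) \<partial>lborel)"
    by (rule lborel_pair.Fubini') measurable
  also have "\<dots> = (\<integral>\<^sup>+x. ?w (x \<bullet> b) * slice_length b A x \<partial>lborel)"
  proof (rule nn_integral_cong)
    fix x :: 'a
    show "(\<integral>\<^sup>+t. indicator A (x + t *\<^sub>R b) * ?w (x \<bullet> b) \<partial>lborel) = ?w (x \<bullet> b) * slice_length b A x"
      unfolding slice_length_eq_nn_integral[OF A]
      by (subst nn_integral_cmult[symmetric]) (auto simp: mult.commute)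
  qed
  finally show ?thesis .
qed

lemma slice_length_steiner:
  fixes A :: "'a::euclidean_space set"
  assumes A: "A \<in> sets borel" and b: "b \<in> Basis"
  shows "slice_length b (steiner b A) x = slice_length b A x"
proof -
  have *: "{t. x + t *\<^sub>R b \<in> steiner b A}
      = {t. ennreal (2 * \<bar>x \<bullet> b + t\<bar>) < slice_length b A x}"
    using b by (auto simp: steiner_def slice_length_shift[OF A] inner_simps)
  show ?thesis
  proof (cases "slice_length b A x")
    case (real l)
    have "{t. ennreal (2 * \<bar>x \<bullet> b + t\<bar>) < slice_length b A x} = {- l / 2 - x \<bullet> b <..< l / 2 - x \<bullet> b}"
      using real by (auto simp: ennreal_less_iff abs_if field_simps split: if_splits)
    then show ?thesis
      unfolding slice_length_def[of b "steiner b A"] * using real by (simp add: field_simps)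
  next
    case top
    then show ?thesis
      unfolding slice_length_def[of b "steiner b A"] * by (simp add: top.not_eq_extremum[symmetric])
  qed
qed

lemma emeasure_steiner:
  fixes A :: "'a::euclidean_space set"
  assumes A: "A \<in> sets borel" and b: "b \<in> Basis"
  shows "emeasure lborel (steiner b A) = emeasure lborel A"
  using emeasure_eq_slices[OF A b] emeasure_eq_slices[OF steiner_borel[OF A] b]
  by (simp add: slice_length_steiner[OF A b])

text \<open>Let \<open>a\<close>, \<open>b\<close> be the infimum and the supremum of \<open>S\<close>, and \<open>c\<close>, \<open>d\<close> those of \<open>T\<close>. Then \<open>d - a \<le> r\<close> and
  \<open>b - c \<le> r\<close>, and these add up to the claim.\<close>

lemma length_sum_le:
  fixes S T :: "real set"
  assumes "S \<noteq> {}" "T \<noteq> {}" and r: "\<And>s t. s \<in> S \<Longrightarrow> t \<in> T \<Longrightarrow> \<bar>s - t\<bar> \<le> r"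
  shows "emeasure lborel S + emeasure lborel T \<le> ennreal (2 * r)"
proof -
  obtain s0 t0 where s0: "s0 \<in> S" and t0: "t0 \<in> T" using assms by auto
  have bS: "bdd_below S" "bdd_above S" 
    by (rule bdd_belowI[of _ "t0 - r"] bdd_aboveI[of _ "t0 + r"]; use r[OF _ t0] in force)+
  have bT: "bdd_below T" "bdd_above T" 
    by (rule bdd_belowI[of _ "s0 - r"] bdd_aboveI[of _ "s0 + r"]; use r[OF s0] in force)+
  have "Sup T \<le> r + s" if "s \<in> S" for s
    using r[OF that] \<open>T \<noteq> {}\<close> by (intro cSup_least) force+
  then have "Sup T - r \<le> Inf S" using \<open>S \<noteq> {}\<close> by (intro cInf_greatest) force+
  moreover have "Sup S \<le> r + t" if "t \<in> T" for t
    using r[OF _ that] \<open>S \<noteq> {}\<close> by (intro cSup_least) force+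
  then have "Sup S - r \<le> Inf T" using \<open>T \<noteq> {}\<close> by (intro cInf_greatest) force+
  moreover have le: "Inf S \<le> Sup S" "Inf T \<le> Sup T"
    using cInf_le_cSup bS bT assms by blast+
  moreover have "S \<subseteq> {Inf S..Sup S}" "T \<subseteq> {Inf T..Sup T}"
    using bS bT by (auto intro: cInf_lower cSup_upper)
  then have "emeasure lborel S \<le> ennreal (Sup S - Inf S)" "emeasure lborel T \<le> ennreal (Sup T - Inf T)"
    using emeasure_mono[of S "{Inf S..Sup S}" lborel] emeasure_mono[of T "{Inf T..Sup T}" lborel] le
    by simp_all
  then have "emeasure lborel S + emeasure lborel T \<le> ennreal ((Sup S - Inf S) + (Sup T - Inf T))"
    using le by (simp add: ennreal_plus add_mono)
  ultimately show ?thesis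
    by (smt (verit) ennreal_leI order_trans)
qed

text \<open>Steiner symmetrization does not increase the diameter: for two points of the symmetrization, the
  lines through them contain two points of \<open>A\<close> whose \<open>b\<close>-coordinates are at least as far apart.\<close>

lemma dist_steiner_le:
  fixes A :: "'a::euclidean_space set"
  assumes A: "A \<in> sets borel" and b: "b \<in> Basis"
    and D: "\<And>x y. x \<in> A \<Longrightarrow> y \<in> A \<Longrightarrow> dist x y \<le> D"
    and x: "x \<in> steiner b A" and y: "y \<in> steiner b A"
  shows "dist x y \<le> D"
proof -
  define S where "S = {t. x + t *\<^sub>R b \<in> A}"
  define T where "T = {t. y + t *\<^sub>R b \<in> A}"
  define c where "c = x \<bullet> b - y \<bullet> b"
  \<comment> \<open>\<open>T'\<close> is \<open>T\<close> shifted so that \<open>\<bar>s - t\<bar>\<close>, for \<open>s \<in> S\<close> and \<open>t \<in> T'\<close>, is the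
    difference of the \<open>b\<close>-coordinates of the two points of \<open>A\<close>.\<close>
  define T' where "T' = (\<lambda>t. - c + t) ` T"
  have eS: "emeasure lborel S > ennreal (2 * \<bar>x \<bullet> b\<bar>)" and eT: "emeasure lborel T > ennreal (2 * \<bar>y \<bullet> b\<bar>)"
    using x y by (auto simp: steiner_def slice_length_def S_def T_def)
  moreover have "emeasure lborel T' = emeasure lborel T"
  proof -
    have "T' = {t. (y + c *\<^sub>R b) + t *\<^sub>R b \<in> A}"
      unfolding T'_def T_def by (auto simp: algebra_simps image_iff intro!: exI[of _ "_ + c"])
    then show ?thesis
      using slice_length_shift[OF A, of b y c] by (simp add: slice_length_def T_def)
  qed
  ultimately have gt: "emeasure lborel S + emeasure lborel T' > ennreal (2 * (\<bar>x \<bullet> b\<bar> + \<bar>y \<bullet> b\<bar>))"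
    using add_strict_mono[of "ennreal (2 * \<bar>x \<bullet> b\<bar>)" "emeasure lborel S" "ennreal (2 * \<bar>y \<bullet> b\<bar>)" "emeasure lborel T"]
    by (simp add: ennreal_plus[symmetric] distrib_left del: ennreal_plus)
  have "S \<noteq> {}" "T \<noteq> {}"
    using eS eT by (metis emeasure_empty not_less_zero)+
  then have "S \<noteq> {}" "T' \<noteq> {}" by (auto simp: T'_def)
  then obtain s t where st: "s \<in> S" "t \<in> T'" "\<bar>s - t\<bar> > \<bar>x \<bullet> b\<bar> + \<bar>y \<bullet> b\<bar>"
    using length_sum_le[of S T' "\<bar>x \<bullet> b\<bar> + \<bar>y \<bullet> b\<bar>"] gt by (meson linorder_not_less)
  obtain t' where t': "t' \<in> T" "t = t' - c" using st(2) by (auto simp: T'_def)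
  have "norm (x - y) \<le> norm ((x + s *\<^sub>R b) - (y + t' *\<^sub>R b))"
  proof (rule norm_le_componentwise)
    fix i :: 'a assume i: "i \<in> Basis"
    show "\<bar>(x - y) \<bullet> i\<bar> \<le> \<bar>(x + s *\<^sub>R b - (y + t' *\<^sub>R b)) \<bullet> i\<bar>"
    proof (cases "i = b")
      case True
      then show ?thesis using st(3) t'(2) b by (simp add: inner_simps c_def)
    next
      case False
      then show ?thesis using i b by (simp add: inner_simps inner_Basis)
    qed
  qed
  also have "\<dots> \<le> D"
    using D[of "x + s *\<^sub>R b" "y + t' *\<^sub>R b"] st t' by (simp add: S_def T_def dist_norm)
  finally show ?thesis by (simp add: dist_norm)
qed

lemma reflect_steiner_self:
  assumes A: "A \<in> sets borel" and b: "b \<in> Basis" and x: "x \<in> steiner b A"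
  shows "reflect b x \<in> steiner b A"
proof -
  have "slice_length b A (reflect b x) = slice_length b A x"
    using slice_length_shift[OF A, of b x "- (2 * (x \<bullet> b))"] by (simp add: reflect_def)
  moreover have "reflect b x \<bullet> b = - (x \<bullet> b)"
    using b by (simp add: reflect_def inner_simps)
  ultimately show ?thesis using x by (simp add: steiner_def)
qed

lemma reflect_steiner_other:
  assumes b: "b \<in> Basis" and c: "c \<in> Basis" "c \<noteq> b"
    and inv: "\<And>x. x \<in> A \<Longrightarrow> reflect c x \<in> A" and x: "x \<in> steiner b A"
  shows "reflect c x \<in> steiner b A"
proof -
  have [simp]: "b \<bullet> c = 0" "c \<bullet> b = 0" using b c by (auto simp: inner_Basis)
  have comm: "reflect c (y + t *\<^sub>R b) = reflect c y + t *\<^sub>R b" for y t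
    by (simp add: reflect_def inner_simps)
  have invol: "reflect c (reflect c y) = y" for y
    using c by (simp add: reflect_def inner_simps)
  have "reflect c x + t *\<^sub>R b \<in> A \<longleftrightarrow> x + t *\<^sub>R b \<in> A" for t
    using inv[of "x + t *\<^sub>R b"] inv[of "reflect c (x + t *\<^sub>R b)"] by (auto simp: comm[symmetric] invol)
  then have "slice_length b A (reflect c x) = slice_length b A x"
    by (simp add: slice_length_def)
  moreover have "reflect c x \<bullet> b = x \<bullet> b" by (simp add: reflect_def inner_simps)
  ultimately show ?thesis using x by (simp add: steiner_def)
qed

text \<open>Symmetrizing successively in orthogonal directions keeps the symmetries already obtained.\<close>

lemma ex_symmetrization:
  fixes A C :: "'a::euclidean_space set"
  assumes A: "A \<in> sets borel" and D: "\<And>x y. x \<in> A \<Longrightarrow> y \<in> A \<Longrightarrow> dist x y \<le> D"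
    and C: "C \<subseteq> Basis"
  shows "\<exists>S \<in> sets borel. emeasure lborel S = emeasure lborel A \<and> (\<forall>x\<in>S. \<forall>y\<in>S. dist x y \<le> D)
     \<and> (\<forall>c\<in>C. \<forall>x\<in>S. reflect c x \<in> S)"
proof -
  have "finite C" using C finite_Basis by (rule finite_subset)
  then show ?thesis using C
  proof (induction C)
    case empty
    show ?case by (rule bexI[OF _ A]) (use D in auto)
  next
    case (insert b C)
    then obtain S where S: "S \<in> sets borel" "emeasure lborel S = emeasure lborel A"
      "\<forall>x\<in>S. \<forall>y\<in>S. dist x y \<le> D" "\<forall>c\<in>C. \<forall>x\<in>S. reflect c x \<in> S" by auto
    have b: "b \<in> Basis" using insert by auto
    show ?case
    proof (intro bexI conjI ballI)
      show "steiner b S \<in> sets borel" using S by measurable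
      show "emeasure lborel (steiner b S) = emeasure lborel A"
        using emeasure_steiner S b by metis
      show "dist x y \<le> D" if "x \<in> steiner b S" "y \<in> steiner b S" for x y
        using dist_steiner_le[OF S(1) b _ that, of D] S(3) by blast
      show "reflect c x \<in> steiner b S" if "c \<in> insert b C" "x \<in> steiner b S" for c x
        using that reflect_steiner_self[OF S(1) b] reflect_steiner_other[OF b, of c S x] S(4) insert.prems
        by (cases "c = b") auto
    qed
  qed
qed

text \<open>A set that is symmetric in all coordinate hyperplanes contains \<open>- x\<close> along with \<open>x\<close>, so a bound
  \<open>2 * r\<close> on its diameter places it in the ball of radius \<open>r\<close>.\<close>

theorem isodiametric:
  fixes A :: "'a::euclidean_space set"
  assumes A: "A \<in> sets borel" and r: "0 \<le> r"
    and D: "\<And>x y. x \<in> A \<Longrightarrow> y \<in> A \<Longrightarrow> dist x y \<le> 2 * r"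
  shows "emeasure lborel A \<le> ennreal (unit_ball_vol (real DIM('a)) * r ^ DIM('a))"
proof -
  obtain S :: "'a set" where S: "S \<in> sets borel" "emeasure lborel S = emeasure lborel A"
      "\<And>x y. x\<in>S \<Longrightarrow> y\<in>S \<Longrightarrow> dist x y \<le> 2 * r" "\<And>c x. c \<in> Basis \<Longrightarrow> x\<in>S \<Longrightarrow> reflect c x \<in> S"
    using ex_symmetrization[OF A D subset_refl] by metis
  have "S \<subseteq> cball 0 r"
  proof
    fix x assume x: "x \<in> S"
    \<comment> \<open>Reflecting in the directions of \<open>C\<close> one after the other.\<close>
    have "x - (\<Sum>c\<in>C. (2 * (x \<bullet> c)) *\<^sub>R c) \<in> S" if C: "C \<subseteq> Basis" for C
    proof -
      have "finite C" using C finite_Basis by (rule finite_subset)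
      then show ?thesis using C
      proof (induction C)
        case empty
        then show ?case using x by simp
      next
        case (insert c C)
        let ?y = "x - (\<Sum>c\<in>C. (2 * (x \<bullet> c)) *\<^sub>R c)"
        have "(\<Sum>i\<in>C. (2 * (x \<bullet> i)) *\<^sub>R i) \<bullet> c = (\<Sum>i\<in>C. 0)"
          unfolding inner_sum_left using insert by (intro sum.cong) (auto simp: inner_Basis subset_iff)
        then have "reflect c ?y = x - (\<Sum>c\<in>insert c C. (2 * (x \<bullet> c)) *\<^sub>R c)"
          using insert by (simp add: reflect_def inner_simps)
        then show ?case using S(4)[of c ?y] insert by auto
      qed
    qed
    then have "x - (\<Sum>c\<in>Basis. (2 * (x \<bullet> c)) *\<^sub>R c) \<in> S" by blast
    also have "(\<Sum>c\<in>Basis. (2 * (x \<bullet> c)) *\<^sub>R c) = 2 *\<^sub>R x"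
      by (simp add: scaleR_scaleR[symmetric] scaleR_sum_right[symmetric] euclidean_representation del: scaleR_scaleR)
    finally have "- x \<in> S" by (simp add: scaleR_2)
    then have "dist x (- x) \<le> 2 * r" using S(3)[OF x] by blast
    then have "norm (2 *\<^sub>R x) \<le> 2 * r" by (simp add: dist_norm scaleR_2)
    then show "x \<in> cball 0 r" by simp
  qed
  then have "emeasure lborel S \<le> emeasure lborel (cball (0::'a) r)"
    by (intro emeasure_mono) auto
  then show ?thesis using S(2) r by (simp add: emeasure_cball)
qed

section \<open>The measure of the edges between two sets\<close>

text \<open>The edges between \<open>X\<close> and \<open>Y\<close> in the large-distance graph, as ordered pairs.\<close>

definition far_pairs :: "'a::metric_space set \<Rightarrow> 'a set \<Rightarrow> ('a \<times> 'a) set" where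
  "far_pairs X Y = {(x, y). x \<in> X \<and> y \<in> Y \<and> dist x y > 2}"

text \<open>The measure of the set of edges between \<open>X\<close> and \<open>Y\<close>. As a real number it is meaningful for \<open>X\<close> and \<open>Y\<close>
  of finite measure. For Borel \<open>A\<close> of finite measure, the edge number of \<open>A\<close> is half of \<open>far_measure A A\<close>.\<close>

definition far_measure :: "'a::euclidean_space set \<Rightarrow> 'a set \<Rightarrow> real" where
  "far_measure X Y = measure lborel (far_pairs X Y)"

text \<open>The degree of \<open>x\<close> into \<open>Y\<close>. The vertex \<open>x\<close> need not belong to \<open>Y\<close>.\<close>

definition far_degree :: "'a::euclidean_space set \<Rightarrow> 'a \<Rightarrow> real" where
  "far_degree Y x = measure lborel {y \<in> Y. dist x y > 2}"

lemma fmeasurable_lborel_sets: "X \<in> fmeasurable lborel \<Longrightarrow> X \<in> sets borel"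
  by (auto dest: fmeasurableD)

lemma sets_lborel_pair:
  "sets (lborel \<Otimes>\<^sub>M lborel :: ('a::euclidean_space \<times> 'b::euclidean_space) measure) = sets borel"
  by (simp only: lborel_prod sets_lborel)

lemma fmeasurable_lborel_Times:
  fixes X :: "'a::euclidean_space set" and Y :: "'b::euclidean_space set"
  assumes X: "X \<in> fmeasurable lborel" and Y: "Y \<in> fmeasurable lborel"
  shows "X \<times> Y \<in> fmeasurable lborel"
    and "measure lborel (X \<times> Y) = measure lborel X * measure lborel Y"
proof -
  have "emeasure lborel (X \<times> Y) = emeasure lborel X * emeasure lborel Y"
    using lborel.emeasure_pair_measure_Times[of X lborel Y] X Y by (simp add: lborel_prod fmeasurable_lborel_sets)
  also have "\<dots> = ennreal (measure lborel X * measure lborel Y)"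
    using X Y by (simp add: emeasure_eq_measure2 ennreal_mult)
  finally have e: "emeasure lborel (X \<times> Y) = ennreal (measure lborel X * measure lborel Y)" .
  have "X \<in> sets borel" "Y \<in> sets borel" using X Y by (auto dest: fmeasurableD)
  then have "X \<times> Y \<in> sets lborel" by (simp add: borel_Times)
  then show "X \<times> Y \<in> fmeasurable lborel" using e by (intro fmeasurableI) auto
  show "measure lborel (X \<times> Y) = measure lborel X * measure lborel Y"
    using e by (simp add: measure_def)
qed

lemma far_pairs_borel:
  fixes X Y :: "'a::euclidean_space set"
  assumes "X \<in> sets borel" "Y \<in> sets borel"
  shows "far_pairs X Y \<in> sets borel"
proof -
  have "open {z::'a \<times> 'a. 2 < dist (fst z) (snd z)}"
    by (intro open_Collect_less continuous_intros)
  then have "X \<times> Y \<inter> {z. 2 < dist (fst z) (snd z)} \<in> sets borel"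
    using assms by (intro sets.Int borel_Times) auto
  also have "X \<times> Y \<inter> {z. 2 < dist (fst z) (snd z)} = far_pairs X Y"
    by (auto simp: far_pairs_def)
  finally show ?thesis .
qed

lemma far_pairs_fmeasurable:
  assumes "X \<in> fmeasurable lborel" "Y \<in> fmeasurable lborel"
  shows "far_pairs X Y \<in> fmeasurable lborel"
proof (rule fmeasurableI2)
  show "X \<times> Y \<in> fmeasurable lborel" using assms by (rule fmeasurable_lborel_Times)
  show "far_pairs X Y \<subseteq> X \<times> Y" by (auto simp: far_pairs_def)
  show "far_pairs X Y \<in> sets lborel" using assms far_pairs_borel by (auto dest!: fmeasurableD)
qed

lemma far_measure_nonneg [simp]: "0 \<le> far_measure X Y"
  by (simp add: far_measure_def)

lemma far_measure_le:
  assumes "X \<in> fmeasurable lborel" "Y \<in> fmeasurable lborel"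
  shows "far_measure X Y \<le> measure lborel X * measure lborel Y"
  unfolding far_measure_def fmeasurable_lborel_Times(2)[OF assms, symmetric]
  using assms fmeasurable_lborel_Times(1)[OF assms] far_pairs_fmeasurable[OF assms]
  by (intro measure_mono_fmeasurable) (auto simp: far_pairs_def dest: fmeasurableD)

lemma far_measure_Un:
  assumes "X \<in> fmeasurable lborel" "X' \<in> fmeasurable lborel" "Y \<in> fmeasurable lborel" "X \<inter> X' = {}"
  shows "far_measure (X \<union> X') Y = far_measure X Y + far_measure X' Y"
proof -
  have "far_pairs (X \<union> X') Y = far_pairs X Y \<union> far_pairs X' Y" by (auto simp: far_pairs_def)
  moreover have "far_pairs X Y \<inter> far_pairs X' Y = {}" using assms by (auto simp: far_pairs_def)
  moreover have "far_pairs X Y \<in> fmeasurable lborel" "far_pairs X' Y \<in> fmeasurable lborel"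
    using assms by (auto intro: far_pairs_fmeasurable)
  ultimately show ?thesis
    unfolding far_measure_def using measure_Union[of lborel "far_pairs X Y" "far_pairs X' Y"]
    by (simp add: fmeasurableD2 fmeasurable_lborel_sets)
qed

lemma far_measure_commute:
  fixes X Y :: "'a::euclidean_space set"
  assumes "X \<in> sets borel" "Y \<in> sets borel"
  shows "far_measure X Y = far_measure Y X"
proof -
  have b: "far_pairs X Y \<in> sets (lborel \<Otimes>\<^sub>M lborel)"
    unfolding sets_lborel_pair by (rule far_pairs_borel[OF assms])
  have "emeasure (lborel \<Otimes>\<^sub>M lborel) (far_pairs X Y)
     = emeasure (distr (lborel \<Otimes>\<^sub>M lborel) (lborel \<Otimes>\<^sub>M lborel) (\<lambda>(x, y). (y, x))) (far_pairs X Y)"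
    using lborel_pair.distr_pair_swap[where ?'a='a and ?'b='a] by simp
  also have "\<dots> = emeasure (lborel \<Otimes>\<^sub>M lborel) ((\<lambda>(x, y). (y, x)) -` far_pairs X Y)"
    using b by (subst emeasure_distr) (auto simp: space_pair_measure)
  also have "(\<lambda>(x, y). (y, x)) -` far_pairs X Y = far_pairs Y X"
    by (auto simp: far_pairs_def dist_commute)
  finally show ?thesis by (simp add: far_measure_def measure_def lborel_prod)
qed

lemma emeasure_far_pairs:
  fixes X Y :: "'a::euclidean_space set"
  assumes "X \<in> sets borel" "Y \<in> sets borel"
  shows "emeasure lborel (far_pairs X Y)
    = (\<integral>\<^sup>+x. emeasure lborel {y \<in> Y. dist x y > 2} * indicator X x \<partial>lborel)"
proof -
  have "emeasure lborel (far_pairs X Y) = (\<integral>\<^sup>+x. emeasure lborel (Pair x -` far_pairs X Y) \<partial>lborel)"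
    using lborel.emeasure_pair_measure_alt[of "far_pairs X Y" lborel] far_pairs_borel[OF assms]
    by (simp only: sets_lborel_pair lborel_prod sets_lborel)
  also have "\<dots> = (\<integral>\<^sup>+x. emeasure lborel {y \<in> Y. dist x y > 2} * indicator X x \<partial>lborel)"
  proof (rule nn_integral_cong)
    fix x
    have "Pair x -` far_pairs X Y = (if x \<in> X then {y \<in> Y. dist x y > 2} else {})"
      by (auto simp: far_pairs_def)
    then show "emeasure lborel (Pair x -` far_pairs X Y)
        = emeasure lborel {y \<in> Y. dist x y > 2} * indicator X x" by simp
  qed
  finally show ?thesis .
qed

lemma far_neighbours_fmeasurable:
  fixes Y :: "'a::euclidean_space set"
  assumes Y: "Y \<in> fmeasurable lborel"
  shows "{y \<in> Y. dist x y > 2} \<in> fmeasurable lborel"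
proof -
  have "open {y. 2 < dist x y}"
    by (intro open_Collect_less continuous_intros)
  then have "Y \<inter> {y. dist x y > 2} \<in> fmeasurable lborel"
    using Y by (intro fmeasurable_Int_fmeasurable) auto
  then show ?thesis by (simp add: Int_def)
qed

lemma far_measure_le_degree:
  assumes X: "X \<in> fmeasurable lborel" and Y: "Y \<in> fmeasurable lborel"
    and D: "\<And>x. x \<in> X \<Longrightarrow> far_degree Y x \<le> D" and "0 \<le> D"
  shows "far_measure X Y \<le> measure lborel X * D"
proof -
  have [measurable]: "X \<in> sets borel" "Y \<in> sets borel" using X Y by (auto dest: fmeasurableD)
  have "emeasure lborel (far_pairs X Y)
      = (\<integral>\<^sup>+x. emeasure lborel {y \<in> Y. dist x y > 2} * indicator X x \<partial>lborel)"
    by (rule emeasure_far_pairs) auto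
  also have "\<dots> \<le> (\<integral>\<^sup>+x. ennreal D * indicator X x \<partial>lborel)"
  proof (rule nn_integral_mono)
    fix x
    show "emeasure lborel {y \<in> Y. dist x y > 2} * indicator X x \<le> ennreal D * indicator X x"
      using D[of x] far_neighbours_fmeasurable[OF Y, of x]
      by (auto simp: far_degree_def emeasure_eq_measure2 ennreal_leI split: split_indicator)
  qed
  also have "\<dots> = ennreal D * emeasure lborel X"
    by (rule nn_integral_cmult_indicator) auto
  also have "\<dots> = ennreal (measure lborel X * D)"
    using X \<open>0 \<le> D\<close> by (simp add: emeasure_eq_measure2 ennreal_mult mult.commute)
  finally show ?thesis
    unfolding far_measure_def using far_pairs_fmeasurable[OF X Y] \<open>0 \<le> D\<close>
    by (simp add: emeasure_eq_measure2)
qed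

lemma sphere_null: "sphere x r \<in> null_sets (lborel :: 'a::euclidean_space measure)"
  if "r > 0"
proof -
  have "sphere x r \<in> null_sets (lebesgue :: 'a measure)"
    using negligible_sphere[of x r] by (simp add: negligible_iff_null_sets)
  then show ?thesis
    using null_sets_completion_iff[of "sphere x r" lborel] by (simp add: closed_sphere borel_closed)
qed

text \<open>A distance of exactly \<open>2\<close> between the two sets is enough for all pairs to be edges up to a null set, because
  spheres are null.\<close>

lemma far_measure_eq_product:
  assumes X: "X \<in> fmeasurable lborel" and Y: "Y \<in> fmeasurable lborel"
    and far: "\<And>x y. x \<in> X \<Longrightarrow> y \<in> Y \<Longrightarrow> dist x y \<ge> 2"
  shows "far_measure X Y = measure lborel X * measure lborel Y"
proof -
  have [measurable]: "X \<in> sets borel" "Y \<in> sets borel" using X Y by (auto dest: fmeasurableD)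
  have "emeasure lborel (far_pairs X Y)
      = (\<integral>\<^sup>+x. emeasure lborel {y \<in> Y. dist x y > 2} * indicator X x \<partial>lborel)"
    by (rule emeasure_far_pairs) auto
  also have "\<dots> = (\<integral>\<^sup>+x. emeasure lborel Y * indicator X x \<partial>lborel)"
  proof (rule nn_integral_cong)
    fix x
    show "emeasure lborel {y \<in> Y. dist x y > 2} * indicator X x = emeasure lborel Y * indicator X x"
    proof (cases "x \<in> X")
      case True
      have "emeasure lborel (Y - sphere x 2) = emeasure lborel Y"
        by (rule emeasure_Diff_null_set) (auto simp: sphere_null)
      moreover have "Y - sphere x 2 = {y \<in> Y. dist x y > 2}"
        using far[OF True] by (auto simp: less_le)
      ultimately show ?thesis by simp
    qed simp
  qed
  also have "\<dots> = emeasure lborel Y * emeasure lborel X"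
    by (rule nn_integral_cmult_indicator) auto
  also have "\<dots> = ennreal (measure lborel X * measure lborel Y)"
    using X Y by (simp add: emeasure_eq_measure2 ennreal_mult mult.commute)
  finally show ?thesis
    unfolding far_measure_def by (simp add: measure_def)
qed

text \<open>A complete bipartite pair (up to a null set) remains complete when both sides shrink.\<close>

lemma far_measure_full_mono:
  assumes fm: "X \<in> fmeasurable lborel" "Y \<in> fmeasurable lborel" "X' \<in> fmeasurable lborel" "Y' \<in> fmeasurable lborel"
    and sub: "X' \<subseteq> X" "Y' \<subseteq> Y"
    and full: "far_measure X Y = measure lborel X * measure lborel Y"
  shows "far_measure X' Y' = measure lborel X' * measure lborel Y'"
proof -
  have left: "far_measure U' V = measure lborel U' * measure lborel V"
    if "U' \<subseteq> U" and "U \<in> fmeasurable lborel" "U' \<in> fmeasurable lborel" "V \<in> fmeasurable lborel"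
      and "far_measure U V = measure lborel U * measure lborel V" for U U' V :: "'a set"
  proof -
    have d: "U - U' \<in> fmeasurable lborel" using that by (simp add: fmeasurable.Diff)
    have "far_measure U V = far_measure U' V + far_measure (U - U') V"
      using far_measure_Un[of U' "U - U'" V] that d by (simp add: Un_absorb1)
    moreover have "measure lborel U = measure lborel U' + measure lborel (U - U')"
      using measure_Union[of lborel U' "U - U'"] that d by (simp add: Un_absorb1 fmeasurable_lborel_sets fmeasurableD2)
    moreover have "far_measure (U - U') V \<le> measure lborel (U - U') * measure lborel V"
      using d that by (intro far_measure_le)
    moreover have "far_measure U' V \<le> measure lborel U' * measure lborel V"
      using that by (intro far_measure_le)
    ultimately show ?thesis using that by (simp add: distrib_right)
  qed
  have b: "X' \<in> sets borel" "Y' \<in> sets borel" "Y \<in> sets borel" using fm by (auto dest: fmeasurableD)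
  have "far_measure Y X' = measure lborel Y * measure lborel X'"
    using left[OF sub(1) fm(1,3,2) full] far_measure_commute[OF b(1,3)] by simp
  from left[OF sub(2) fm(2,4,3) this] show ?thesis
    using far_measure_commute[OF b(1,2)] by simp
qed

text \<open>The degree is continuous because the indicator of the neighbourhood of \<open>p\<close> can only jump on the
  sphere of radius \<open>2\<close> about \<open>p\<close>, which is null.\<close>

lemma continuous_far_degree:
  fixes Y :: "'a::euclidean_space set"
  assumes Y: "Y \<in> fmeasurable lborel"
  shows "continuous_on S (far_degree Y)"
proof (rule continuous_at_imp_continuous_on, rule ballI)
  fix p :: 'a
  show "isCont (far_degree Y) p"
    unfolding continuous_at_sequentially
  proof (intro allI impI)
    fix u :: "nat \<Rightarrow> 'a" assume u: "u \<longlonglongrightarrow> p"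
    let ?f = "\<lambda>x y. indicator {y \<in> Y. dist x y > 2} y :: real"
    have deg: "far_degree Y x = (\<integral>y. ?f x y \<partial>lborel)" for x
      by (simp add: far_degree_def)
    have m: "{y \<in> Y. dist x y > 2} \<in> sets lborel" for x
      using far_neighbours_fmeasurable[OF Y] by (rule fmeasurableD)
    have "(\<lambda>n. \<integral>y. ?f (u n) y \<partial>lborel) \<longlonglongrightarrow> (\<integral>y. ?f p y \<partial>lborel)"
    proof (rule integral_dominated_convergence[where w = "indicator Y"])
      show "integrable lborel (indicator Y :: 'a \<Rightarrow> real)"
        using Y by (simp add: fmeasurable_def integrable_indicator_iff)
      show "AE y in lborel. (\<lambda>n. ?f (u n) y) \<longlonglongrightarrow> ?f p y"
      proof (rule AE_I')
        show "sphere p 2 \<in> null_sets lborel" by (rule sphere_null) simp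
        show "{y \<in> space lborel. \<not> (\<lambda>n. ?f (u n) y) \<longlonglongrightarrow> ?f p y} \<subseteq> sphere p 2"
        proof safe
          fix y assume n: "\<not> (\<lambda>n. ?f (u n) y) \<longlonglongrightarrow> ?f p y"
          have t: "(\<lambda>n. dist (u n) y) \<longlonglongrightarrow> dist p y" using u by (intro tendsto_intros)
          show "y \<in> sphere p 2"
          proof (rule ccontr)
            assume "y \<notin> sphere p 2"
            then consider "dist p y > 2" | "dist p y < 2" by force
            then have "\<forall>\<^sub>F n in sequentially. ?f (u n) y = ?f p y"
            proof cases
              case 1
              show ?thesis using order_tendstoD(1)[OF t 1]
                by eventually_elim (use 1 in \<open>auto simp: indicator_def\<close>)
            next
              case 2
              show ?thesis using order_tendstoD(2)[OF t 2]
                by eventually_elim (use 2 in \<open>auto simp: indicator_def\<close>)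
            qed
            from tendsto_eventually[OF this] n show False by contradiction
          qed
        qed
      qed
      show "AE y in lborel. norm (?f (u n) y) \<le> indicator Y y" for n
        by (intro AE_I2) (auto simp: indicator_def)
    qed (use m in auto)
    then show "(far_degree Y \<circ> u) \<longlonglongrightarrow> far_degree Y p"
      by (simp add: deg comp_def)
  qed
qed

section \<open>Cliques\<close>

text \<open>A finite clique of the large-distance graph.\<close>

definition far_clique :: "'a::metric_space set \<Rightarrow> bool" where
  "far_clique F \<longleftrightarrow> finite F \<and> pairwise (\<lambda>x y. dist x y > 2) F"

text \<open>The graph on \<open>S\<close> contains no clique with exactly \<open>k\<close> vertices; no exceptional null set is allowed here.\<close>

definition clique_free :: "nat \<Rightarrow> 'a::metric_space set \<Rightarrow> bool" where
  "clique_free k S \<longleftrightarrow> \<not> (\<exists>F\<subseteq>S. far_clique F \<and> card F = k)"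

text \<open>Being an edge is an open condition, so the vertices of a finite clique can be moved a little.\<close>

lemma far_clique_room:
  fixes F :: "'a::metric_space set"
  assumes "far_clique F"
  obtains \<epsilon> where "\<epsilon> > 0" "\<And>x y x' y'. \<lbrakk>x \<in> F; y \<in> F; x \<noteq> y; dist x x' < \<epsilon>; dist y y' < \<epsilon>\<rbrakk> \<Longrightarrow> dist x' y' > 2"
proof -
  let ?P = "{(x, y). x \<in> F \<and> y \<in> F \<and> x \<noteq> y}"
  have fin: "finite ?P" using assms by (auto simp: far_clique_def intro: finite_subset[of _ "F \<times> F"])
  define D where "D = insert 1 ((\<lambda>(x, y). dist x y - 2) ` ?P)"
  have D: "finite D" "D \<noteq> {}" using fin by (auto simp: D_def)
  have "Min D > 0"
    using D assms by (auto simp: D_def far_clique_def pairwise_def)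
  moreover have "dist x' y' > 2" if h: "x \<in> F" "y \<in> F" "x \<noteq> y" "dist x x' < Min D / 2" "dist y y' < Min D / 2" for x y x' y'
  proof -
    have "Min D \<le> dist x y - 2" using D h by (intro Min_le) (auto simp: D_def)
    moreover have "dist x y \<le> dist x x' + dist x' y' + dist y y'"
      using dist_triangle[of x y x'] dist_triangle[of x' y y'] by (simp add: dist_commute)
    ultimately show ?thesis using h by linarith
  qed
  ultimately show ?thesis using that[of "Min D / 2"] by auto
qed

lemma clique_free_closure:
  assumes "clique_free k S"
  shows "clique_free k (closure S)"
  unfolding clique_free_def
proof safe
  fix F assume F: "F \<subseteq> closure S" "far_clique F" and k: "k = card F"
  obtain \<epsilon> where e: "\<epsilon> > 0" "\<And>x y x' y'. \<lbrakk>x \<in> F; y \<in> F; x \<noteq> y; dist x x' < \<epsilon>; dist y y' < \<epsilon>\<rbrakk> \<Longrightarrow> dist x' y' > 2"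
    using far_clique_room[OF F(2)] by metis
  have "\<forall>x\<in>F. \<exists>x'\<in>S. dist x' x < \<epsilon>" using F(1) e(1) closure_approachable by blast
  then obtain f where f: "\<And>x. x \<in> F \<Longrightarrow> f x \<in> S \<and> dist x (f x) < \<epsilon>" by (metis dist_commute)
  have far: "dist (f x) (f y) > 2" if "x \<in> F" "y \<in> F" "x \<noteq> y" for x y
    using e(2) that f by blast
  then have inj: "inj_on f F" by (intro inj_onI) (metis dist_self not_numeral_less_zero)
  have "far_clique (f ` F)" using F(2) far by (fastforce simp: far_clique_def pairwise_def)
  moreover have "card (f ` F) = k" using inj k by (simp add: card_image)
  ultimately show False using assms f unfolding clique_free_def by blast
qed

lemma clique_free_neighbours:
  assumes "clique_free (Suc k) S" "p \<in> S"
  shows "clique_free k {x \<in> S. dist p x > 2}"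
  unfolding clique_free_def
proof safe
  fix F assume F: "F \<subseteq> {x \<in> S. dist p x > 2}" "far_clique F" "k = card F"
  have "p \<notin> F" using F by auto
  then have "card (insert p F) = Suc k" using F by (simp add: far_clique_def)
  moreover have "far_clique (insert p F)"
    using F by (auto simp: far_clique_def pairwise_insert dist_commute)
  ultimately show False using assms F unfolding clique_free_def by blast
qed

lemma clique_free_mono: "clique_free k S \<Longrightarrow> T \<subseteq> S \<Longrightarrow> clique_free k T"
  by (auto simp: clique_free_def)

lemma clique_free_bounded:
  fixes S :: "'a::metric_space set"
  shows "clique_free k S \<Longrightarrow> bounded S"
proof (induction k arbitrary: S)
  case 0
  then show ?case by (auto simp: clique_free_def far_clique_def dest: spec[of _ "{}"])
next
  case (Suc k)
  show ?case
  proof (cases "S = {}")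
    case False
    then obtain p where p: "p \<in> S" by auto
    have "bounded {x \<in> S. dist p x > 2}"
      using Suc clique_free_neighbours p by blast
    then have "bounded ({x \<in> S. dist p x > 2} \<union> cball p 2)" by simp
    then show ?thesis by (rule bounded_subset) auto
  qed simp
qed

section \<open>Turan's theorem for the large-distance graph\<close>

text \<open>\<open>A\<close> carries, up to null sets of pairs, the balanced complete \<open>m\<close>-partite graph with parts
  \<open>B 1\<close>, ..., \<open>B m\<close>.\<close>

definition turan_partition :: "nat \<Rightarrow> 'a::euclidean_space set \<Rightarrow> (nat \<Rightarrow> 'a set) \<Rightarrow> bool" where
  "turan_partition m A B \<longleftrightarrow>
     disjoint_family_on B {1..m} \<and> (\<Union>i\<in>{1..m}. B i) = A \<and>
     (\<forall>i\<in>{1..m}. B i \<in> fmeasurable lborel \<and> measure lborel (B i) = measure lborel A / real m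
        \<and> far_measure (B i) (B i) = 0) \<and>
     (\<forall>i\<in>{1..m}. \<forall>j\<in>{1..m}. i \<noteq> j \<longrightarrow>
        far_measure (B i) (B j) = measure lborel (B i) * measure lborel (B j))"

text \<open>Here \<open>n\<close> is the total measure, \<open>\<Delta>\<close> the maximal degree, and the left-hand side is the bound
  on the number of edges that the induction hypothesis gives. Completing the square exhibits the
  maximum over \<open>\<Delta>\<close> and the unique \<open>\<Delta>\<close> that attains it.\<close>

lemma turan_identity:
  fixes M n \<Delta> :: real
  assumes "M > 0"
  shows "(1 - 1 / M) * \<Delta>\<^sup>2 + 2 * ((n - \<Delta>) * \<Delta>)
    = (1 - 1 / (M + 1)) * n\<^sup>2 - (M + 1) / M * (\<Delta> - n * M / (M + 1))\<^sup>2"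
proof -
  have "M * (M + 1) * ((1 - 1 / M) * \<Delta>\<^sup>2 + 2 * ((n - \<Delta>) * \<Delta>))
    = (M + 1) * ((M - 1) * \<Delta>\<^sup>2) + 2 * M * (M + 1) * ((n - \<Delta>) * \<Delta>)"
    using assms by (simp add: field_simps)
  moreover have "M * (M + 1) * ((1 - 1 / (M + 1)) * n\<^sup>2 - (M + 1) / M * (\<Delta> - n * M / (M + 1))\<^sup>2)
    = M * M * n\<^sup>2 - (\<Delta> * (M + 1) - n * M)\<^sup>2"
  proof -
    have 1: "\<Delta> - n * M / (M + 1) = (\<Delta> * (M + 1) - n * M) / (M + 1)" using assms by (simp add: field_simps)
    have 2: "M * (M + 1) * ((1 - 1 / (M + 1)) * n\<^sup>2) = M * M * n\<^sup>2" using assms by (simp add: field_simps)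
    have "M * (M + 1) * ((M + 1) / M * ((\<Delta> * (M + 1) - n * M) / (M + 1))\<^sup>2) 
       = (M + 1) * (M + 1) * ((\<Delta> * (M + 1) - n * M) / (M + 1))\<^sup>2" using assms by simp
    also have "\<dots> = (\<Delta> * (M + 1) - n * M)\<^sup>2" using assms by (simp add: power_divide power2_eq_square)
    finally show ?thesis unfolding 1 right_diff_distrib 2 by simp
  qed
  moreover have "(M + 1) * ((M - 1) * \<Delta>\<^sup>2) + 2 * M * (M + 1) * ((n - \<Delta>) * \<Delta>)
     = M * M * n\<^sup>2 - (\<Delta> * (M + 1) - n * M)\<^sup>2"
    by (simp add: algebra_simps power2_eq_square)
  ultimately have "M * (M + 1) * ((1 - 1 / M) * \<Delta>\<^sup>2 + 2 * ((n - \<Delta>) * \<Delta>))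
    = M * (M + 1) * ((1 - 1 / (M + 1)) * n\<^sup>2 - (M + 1) / M * (\<Delta> - n * M / (M + 1))\<^sup>2)" by simp
  then show ?thesis using assms by (subst (asm) mult_left_cancel) auto
qed

lemma bounded_borel_fmeasurable:
  fixes A :: "'a::euclidean_space set"
  shows "A \<in> sets borel \<Longrightarrow> bounded A \<Longrightarrow> A \<in> fmeasurable lborel"
  by (rule fmeasurableI) (simp, erule emeasure_bounded_finite)

lemma far_measure_empty [simp]: "far_measure {} Y = 0" "far_measure X {} = 0"
  by (simp_all add: far_measure_def far_pairs_def)

lemma clique_freeD: "clique_free k S \<Longrightarrow> F \<subseteq> S \<Longrightarrow> far_clique F \<Longrightarrow> card F \<noteq> k"
  by (auto simp: clique_free_def)

text \<open>The measure version of Turan's theorem for the large-distance graph, by induction on \<open>m\<close>. Let \<open>p\<close> have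
  maximal degree, \<open>N\<close> its neighbourhood in \<open>A\<close>, and \<open>S = A - N\<close>. The induction hypothesis
  applies to \<open>N\<close>, and an edge not inside \<open>N\<close> has an end in \<open>S\<close>, where degrees are at most that of
  \<open>p\<close>. In the case of equality \<open>S\<close> contains no edges, is completely joined to \<open>N\<close>, and has the
  right measure to serve as an additional part.\<close>

theorem turan_far:
  fixes A :: "'a::euclidean_space set"
  assumes "1 \<le> m" "A \<in> sets borel" "clique_free (Suc m) A"
  shows "far_measure A A \<le> (1 - 1 / real m) * (measure lborel A)\<^sup>2 \<and>
    (far_measure A A = (1 - 1 / real m) * (measure lborel A)\<^sup>2 \<longrightarrow> (\<exists>B. turan_partition m A B))"
  using assms
proof (induction m arbitrary: A rule: nat_induct_at_least)
  case base
  have fm: "A \<in> fmeasurable lborel"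
    by (rule bounded_borel_fmeasurable[OF base(1) clique_free_bounded[OF base(2)]])
  have "far_pairs A A = {}"
  proof (rule ccontr)
    assume "far_pairs A A \<noteq> {}"
    then obtain x y where xy: "x \<in> A" "y \<in> A" "dist x y > 2" by (auto simp: far_pairs_def)
    then have "x \<noteq> y" by auto
    then have "card {x, y} = Suc 1" by simp
    moreover have "far_clique {x, y}"
      using xy by (auto simp: far_clique_def pairwise_def dist_commute)
    moreover have "{x, y} \<subseteq> A" using xy by simp
    ultimately show False using clique_freeD[OF base(2)] by metis
  qed
  then have 0: "far_measure A A = 0" by (simp add: far_measure_def)
  then have "turan_partition 1 A (\<lambda>_. A)"
    using fm by (simp add: turan_partition_def disjoint_family_on_def)
  then show ?case using 0 by auto
next
  case (Suc m)
  have fm: "A \<in> fmeasurable lborel"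
    by (rule bounded_borel_fmeasurable[OF Suc.prems(1) clique_free_bounded[OF Suc.prems(2)]])
  show ?case
  proof (cases "A = {}")
    case True
    then have "turan_partition (Suc m) A (\<lambda>_. {})"
      by (auto simp: turan_partition_def disjoint_family_on_def)
    then show ?thesis using True by auto
  next
    case False
    \<comment> \<open>The maximal degree may fail to be attained on \<open>A\<close>; it is attained on the closure, which is
      still clique-free.\<close>
    have cf: "clique_free (Suc (Suc m)) (closure A)"
      using Suc.prems by (intro clique_free_closure)
    have "compact (closure A)"
      using clique_free_bounded[OF Suc.prems(2)] by (simp add: compact_closure)
    then obtain p where p: "p \<in> closure A" "\<And>q. q \<in> closure A \<Longrightarrow> far_degree A q \<le> far_degree A p"
      using continuous_attains_sup[of "closure A" "far_degree A"] continuous_far_degree[OF fm] False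
      by auto
    define N where "N = {y \<in> A. dist p y > 2}"
    define S where "S = A - N"
    define \<Delta> where "\<Delta> = measure lborel N"
    define n where "n = measure lborel A"
    define s where "s = measure lborel S"
    have Nfm: "N \<in> fmeasurable lborel" unfolding N_def by (rule far_neighbours_fmeasurable[OF fm])
    have Sfm: "S \<in> fmeasurable lborel" unfolding S_def using fm Nfm by (rule fmeasurable.Diff)
    have NS: "N \<inter> S = {}" "N \<union> S = A" by (auto simp: N_def S_def)
    note b = fmeasurable_lborel_sets[OF fm] fmeasurable_lborel_sets[OF Nfm] fmeasurable_lborel_sets[OF Sfm]
    have cfN: "clique_free (Suc m) N"
      using clique_free_neighbours[OF cf p(1)] by (rule clique_free_mono) (use closure_subset in \<open>auto simp: N_def\<close>)
    note IH = Suc.IH[OF b(2) cfN]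
    have ns: "n = \<Delta> + s"
      using measure_Union[of lborel N S] b Nfm Sfm NS by (simp add: n_def \<Delta>_def s_def fmeasurableD2)
    \<comment> \<open>Twice \<open>far_measure S A\<close> counts the pairs inside \<open>S\<close> twice and all other pairs meeting
      \<open>S\<close> once.\<close>
    have "far_measure A A = far_measure N A + far_measure S A"
      using far_measure_Un[OF Nfm Sfm fm NS(1)] NS(2) by simp
    moreover have "far_measure N A = far_measure N N + far_measure S N"
      using far_measure_Un[OF Nfm Sfm Nfm NS(1)] NS(2) far_measure_commute b by metis
    moreover have WSA: "far_measure S A = far_measure S N + far_measure S S"
      using far_measure_Un[OF Nfm Sfm Sfm NS(1)] NS(2) far_measure_commute b by metis
    ultimately have W: "far_measure A A = far_measure N N + 2 * far_measure S A - far_measure S S" by simp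
    have SA: "far_measure S A \<le> (n - \<Delta>) * \<Delta>"
    proof -
      have "far_measure S A \<le> s * \<Delta>"
        unfolding s_def \<Delta>_def
      proof (rule far_measure_le_degree[OF Sfm fm])
        show "far_degree A x \<le> measure lborel N" if "x \<in> S" for x
          using p(2)[of x] that closure_subset[of A] by (auto simp: S_def N_def far_degree_def)
      qed simp
      then show ?thesis using ns by simp
    qed
    have NN: "far_measure N N \<le> (1 - 1 / real m) * \<Delta>\<^sup>2" using IH by (simp add: \<Delta>_def)
    have m: "real m > 0" using Suc.hyps by simp
    have M1: "real (Suc m) = real m + 1" by simp
    define q where "q = (real m + 1) / real m * (\<Delta> - n * real m / (real m + 1))\<^sup>2"
    have q0: "q \<ge> 0" unfolding q_def using m by simp
    have id: "(1 - 1 / real m) * \<Delta>\<^sup>2 + 2 * ((n - \<Delta>) * \<Delta>) = (1 - 1 / (real m + 1)) * n\<^sup>2 - q"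
      unfolding q_def by (rule turan_identity[OF m])
    have ineq: "far_measure A A \<le> (1 - 1 / (real m + 1)) * n\<^sup>2"
      using W SA NN id q0 far_measure_nonneg[of S S] by linarith
    have "\<exists>B. turan_partition (Suc m) A B" if eq: "far_measure A A = (1 - 1 / (real m + 1)) * n\<^sup>2"
    proof -
      \<comment> \<open>Equality overall forces equality in each of the estimates that were added up.\<close>
      have eqs: "q = 0" "far_measure S S = 0" "far_measure N N = (1 - 1 / real m) * \<Delta>\<^sup>2"
          "far_measure S A = (n - \<Delta>) * \<Delta>"
        using eq W SA NN id q0 far_measure_nonneg[of S S] by linarith+
      have \<Delta>: "\<Delta> = n * real m / (real m + 1)"
        using eqs(1) m unfolding q_def by simp
      obtain B where B: "turan_partition m N B" using IH eqs(3) by (auto simp: \<Delta>_def)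
      have \<Delta>m: "\<Delta> / real m = n / (real m + 1)" using \<Delta> m by simp
      have sm: "s = n / (real m + 1)"
      proof -
        have "s = n - n * real m / (real m + 1)" using ns \<Delta> by simp
        then show ?thesis using m by (simp add: field_simps)
      qed
      have BN: "B i \<subseteq> N" "B i \<in> fmeasurable lborel" if "i \<in> {1..m}" for i
        using B that unfolding turan_partition_def by blast+
      have full: "far_measure S N = measure lborel S * measure lborel N"
        using WSA eqs(2,4) ns by (simp add: s_def \<Delta>_def)
      have SB: "far_measure S (B i) = measure lborel S * measure lborel (B i)" if "i \<in> {1..m}" for i
        using far_measure_full_mono[OF Sfm Nfm Sfm BN(2)[OF that] subset_refl BN(1)[OF that] full] .
      have BS: "far_measure (B i) S = measure lborel (B i) * measure lborel S" if "i \<in> {1..m}" for i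
        using SB[OF that] far_measure_commute[OF b(3) fmeasurable_lborel_sets[OF BN(2)[OF that]]] by simp
      define C where "C = B(Suc m := S)"
      have Cm: "C i = B i" if "i \<in> {1..m}" for i using that by (auto simp: C_def)
      have CS: "C (Suc m) = S" by (simp add: C_def)
      have ins: "{1..Suc m} = insert (Suc m) {1..m}" by auto
      have "turan_partition (Suc m) A C"
        unfolding turan_partition_def
      proof (intro conjI ballI impI)
        show "disjoint_family_on C {1..Suc m}"
          unfolding ins using B BN(1) NS(1) Cm CS unfolding turan_partition_def
          by (subst disjoint_family_on_insert) (auto simp: disjoint_family_on_def)
        have "(\<Union>i\<in>{1..m}. C i) = N" using B Cm unfolding turan_partition_def by auto
        then show "(\<Union>i\<in>{1..Suc m}. C i) = A" unfolding ins using CS NS by auto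
      next
        fix i assume i: "i \<in> {1..Suc m}"
        then consider "i = Suc m" | "i \<in> {1..m}" unfolding ins by blast
        then have "C i \<in> fmeasurable lborel \<and> measure lborel (C i) = measure lborel A / real (Suc m)
            \<and> far_measure (C i) (C i) = 0"
        proof cases
          case 1
          then show ?thesis using CS Sfm sm eqs(2) by (simp add: s_def n_def)
        next
          case 2
          then have "measure lborel (B i) = \<Delta> / real m" "far_measure (B i) (B i) = 0"
            using B unfolding turan_partition_def \<Delta>_def by blast+
          then show ?thesis using BN(2)[OF 2] Cm[OF 2] \<Delta>m M1 by (simp add: n_def)
        qed
        then show "C i \<in> fmeasurable lborel" "measure lborel (C i) = measure lborel A / real (Suc m)"
            "far_measure (C i) (C i) = 0" by blast+
        fix j assume j: "j \<in> {1..Suc m}" "i \<noteq> j"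
        then consider "i = Suc m" "j \<in> {1..m}" | "i \<in> {1..m}" "j = Suc m" | "i \<in> {1..m}" "j \<in> {1..m}"
          using i unfolding ins by blast
        then show "far_measure (C i) (C j) = measure lborel (C i) * measure lborel (C j)"
        proof cases
          case 1
          then show ?thesis using SB CS Cm by simp
        next
          case 2
          then show ?thesis using BS CS Cm by simp
        next
          case 3
          then show ?thesis using B Cm j(2) unfolding turan_partition_def by simp
        qed
      qed
      then show ?thesis by blast
    qed
    then show ?thesis using ineq M1 by (simp add: n_def add.commute)
  qed
qed

lemma far_measure_UN:
  assumes "finite I" "\<And>i. i \<in> I \<Longrightarrow> B i \<in> fmeasurable lborel" "Y \<in> fmeasurable lborel" "disjoint_family_on B I"
  shows "far_measure (\<Union>i\<in>I. B i) Y = (\<Sum>i\<in>I. far_measure (B i) Y)"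
  using assms
proof (induction I)
  case (insert i I)
  have "(\<Union>j\<in>I. B j) \<in> fmeasurable lborel" using insert by (intro fmeasurable.finite_UN) auto
  moreover have "B i \<inter> (\<Union>j\<in>I. B j) = {}" "disjoint_family_on B I"
    using insert.prems(3) insert.hyps by (auto simp: disjoint_family_on_insert)
  ultimately show ?case
    using insert far_measure_Un[of "B i" "\<Union>j\<in>I. B j" Y] by simp
qed simp

text \<open>The converse of the equality case in \<open>turan_far\<close>.\<close>

lemma turan_partition_far_measure:
  fixes A :: "'a::euclidean_space set"
  assumes P: "turan_partition m A B" and m: "m \<ge> 1"
  shows "far_measure A A = (1 - 1 / real m) * (measure lborel A)\<^sup>2"
proof -
  have dj: "disjoint_family_on B {1..m}" and U: "(\<Union>i\<in>{1..m}. B i) = A"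
    and fm: "\<And>i. i \<in> {1..m} \<Longrightarrow> B i \<in> fmeasurable lborel"
    and c: "\<And>i. i \<in> {1..m} \<Longrightarrow> measure lborel (B i) = measure lborel A / real m"
    using P unfolding turan_partition_def by blast+
  define c where "c = measure lborel A / real m"
  have fmA: "A \<in> fmeasurable lborel" using fm unfolding U[symmetric] by (intro fmeasurable.finite_UN) auto
  have row: "far_measure (B i) A = (real m - 1) * c\<^sup>2" if i: "i \<in> {1..m}" for i
  proof -
    have "far_measure (B i) A = far_measure A (B i)"
      using fm i fmA by (intro far_measure_commute fmeasurable_lborel_sets)
    also have "\<dots> = (\<Sum>j\<in>{1..m}. far_measure (B j) (B i))"
      using far_measure_UN[of "{1..m}" B "B i"] fm i dj U by simp
    also have "\<dots> = (\<Sum>j\<in>{1..m}. if j = i then 0 else c\<^sup>2)"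
      using P i by (intro sum.cong) (auto simp: turan_partition_def c_def power2_eq_square)
    also have "\<dots> = (\<Sum>j\<in>{1..m} - {i}. c\<^sup>2)"
      by (rule sum.mono_neutral_cong_right) auto
    also have "\<dots> = (real m - 1) * c\<^sup>2"
      using i by (simp add: of_nat_diff)
    finally show ?thesis .
  qed
  have "far_measure A A = (\<Sum>i\<in>{1..m}. far_measure (B i) A)"
    using far_measure_UN[of "{1..m}" B A] fm fmA dj U by simp
  also have "\<dots> = real m * ((real m - 1) * c\<^sup>2)" using row by simp
  also have "\<dots> = (1 - 1 / real m) * (measure lborel A)\<^sup>2"
    using m by (simp add: c_def field_simps power2_eq_square)
  finally show ?thesis .
qed

section \<open>Essential supports\<close>

text \<open>The closed support of Lebesgue measure restricted to \<open>A\<close>. It need not be contained in \<open>A\<close>.\<close>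

definition ess_support :: "'a::euclidean_space set \<Rightarrow> 'a set" where
  "ess_support A = {x. \<forall>\<epsilon>>0. emeasure lborel (A \<inter> ball x \<epsilon>) > 0}"

lemma closed_ess_support:
  assumes "A \<in> sets borel"
  shows "closed (ess_support A)"
  unfolding closed_def open_contains_ball
proof safe
  fix x assume "x \<notin> ess_support A"
  then obtain e where e: "e > 0" "emeasure lborel (A \<inter> ball x e) = 0"
    by (auto simp: ess_support_def zero_less_iff_neq_zero)
  have "ball x e \<subseteq> - ess_support A"
  proof safe
    fix y assume y: "y \<in> ball x e" "y \<in> ess_support A"
    have "A \<inter> ball y (e - dist x y) \<subseteq> A \<inter> ball x e"
    proof safe
      fix z assume "z \<in> ball y (e - dist x y)"
      then show "z \<in> ball x e" using dist_triangle[of x z y] by simp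
    qed
    then have "emeasure lborel (A \<inter> ball y (e - dist x y)) \<le> 0"
      unfolding e(2)[symmetric] using assms by (intro emeasure_mono) auto
    then show False using y unfolding ess_support_def by (auto simp: not_le[symmetric])
  qed
  then show "\<exists>e>0. ball x e \<subseteq> - ess_support A" using e by blast
qed

text \<open>By Lindelof's theorem, countably many balls that meet \<open>A\<close> in null sets cover \<open>A - ess_support A\<close>.\<close>

lemma Diff_ess_support_null:
  assumes A: "A \<in> sets borel"
  shows "A - ess_support A \<in> null_sets lborel"
proof -
  define \<F> where "\<F> = {ball x e |x e. emeasure lborel (A \<inter> ball x e) = 0}"
  obtain \<G> where G: "\<G> \<subseteq> \<F>" "countable \<G>" "\<Union>\<G> = \<Union>\<F>"
    using Lindelof[of \<F>] unfolding \<F>_def by blast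
  have "(\<Union>b\<in>\<G>. A \<inter> b) \<in> null_sets lborel"
    using G A by (intro null_sets_UN') (auto simp: \<F>_def null_sets_def)
  moreover have "A - ess_support A \<subseteq> (\<Union>b\<in>\<G>. A \<inter> b)"
  proof
    fix x assume x: "x \<in> A - ess_support A"
    then obtain e where "e > 0" "emeasure lborel (A \<inter> ball x e) = 0"
      by (auto simp: ess_support_def zero_less_iff_neq_zero)
    then have "x \<in> \<Union>\<F>" unfolding \<F>_def by force
    then show "x \<in> (\<Union>b\<in>\<G>. A \<inter> b)" using x G(3) by auto
  qed
  moreover have "A - ess_support A \<in> sets lborel"
    using A closed_ess_support[OF A] by auto
  ultimately show ?thesis using null_sets_subset by blast
qed

lemma ess_support_measure_pos:
  assumes "X \<in> fmeasurable lborel" "x \<in> ess_support X" "e > 0"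
  shows "X \<inter> ball x e \<in> fmeasurable lborel" "measure lborel (X \<inter> ball x e) > 0"
proof -
  show fm: "X \<inter> ball x e \<in> fmeasurable lborel" using assms(1) by (rule fmeasurable_Int_fmeasurable) simp
  show "measure lborel (X \<inter> ball x e) > 0"
    using assms(2,3) fm by (auto simp: ess_support_def emeasure_eq_measure2)
qed

text \<open>Together with the next lemma, this turns statements about almost all pairs into statements about all
  pairs of points of the supports: small balls about two offending points would contribute a
  product of sets of positive measure to the exceptional set.\<close>

lemma ess_support_dist_le:
  fixes X Y :: "'a::euclidean_space set"
  assumes X: "X \<in> fmeasurable lborel" and Y: "Y \<in> fmeasurable lborel" and 0: "far_measure X Y = 0"
    and x: "x \<in> ess_support X" and y: "y \<in> ess_support Y"
  shows "dist x y \<le> 2"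
proof (rule ccontr)
  define e where "e = (dist x y - 2) / 2"
  assume "\<not> dist x y \<le> 2"
  then have e: "e > 0" by (simp add: e_def)
  have e2: "2 * e = dist x y - 2"
    by (simp add: e_def)
  note X' = ess_support_measure_pos[OF X x e] and Y' = ess_support_measure_pos[OF Y y e]
  have "far_measure (X \<inter> ball x e) (Y \<inter> ball y e)
     = measure lborel (X \<inter> ball x e) * measure lborel (Y \<inter> ball y e)"
  proof (rule far_measure_eq_product[OF X'(1) Y'(1)])
    fix u v assume "u \<in> X \<inter> ball x e" "v \<in> Y \<inter> ball y e"
    then have "dist x u < e" "dist y v < e" by auto
    moreover have "dist x y \<le> dist x u + dist u v + dist y v"
      using dist_triangle[of x y u] dist_triangle[of u y v] by (simp add: dist_commute)
    ultimately show "dist u v \<ge> 2" using e2 by linarith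
  qed
  then have "far_measure (X \<inter> ball x e) (Y \<inter> ball y e) > 0" using X' Y' by simp
  moreover have "far_measure (X \<inter> ball x e) (Y \<inter> ball y e) \<le> far_measure X Y"
    unfolding far_measure_def
    using far_pairs_fmeasurable[OF X'(1) Y'(1)] far_pairs_fmeasurable[OF X Y]
    by (intro measure_mono_fmeasurable) (auto simp: far_pairs_def dest: fmeasurableD)
  ultimately show False using 0 by simp
qed

lemma ess_support_dist_ge:
  fixes X Y :: "'a::euclidean_space set"
  assumes X: "X \<in> fmeasurable lborel" and Y: "Y \<in> fmeasurable lborel"
    and full: "far_measure X Y = measure lborel X * measure lborel Y"
    and x: "x \<in> ess_support X" and y: "y \<in> ess_support Y"
  shows "dist x y \<ge> 2"
proof (rule ccontr)
  define e where "e = (2 - dist x y) / 2"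
  assume "\<not> dist x y \<ge> 2"
  then have e: "e > 0" by (simp add: e_def)
  have e2: "2 * e = 2 - dist x y"
    by (simp add: e_def)
  note X' = ess_support_measure_pos[OF X x e] and Y' = ess_support_measure_pos[OF Y y e]
  have "far_measure (X \<inter> ball x e) (Y \<inter> ball y e)
     = measure lborel (X \<inter> ball x e) * measure lborel (Y \<inter> ball y e)"
    by (rule far_measure_full_mono[OF X Y X'(1) Y'(1) _ _ full]) auto
  then have "far_measure (X \<inter> ball x e) (Y \<inter> ball y e) > 0" using X' Y' by simp
  moreover have "far_pairs (X \<inter> ball x e) (Y \<inter> ball y e) = {}"
  proof -
    have "dist u v \<le> 2" if "dist x u < e" "dist y v < e" for u v
    proof -
      have "dist u v \<le> dist x u + dist x y + dist y v"
        using dist_triangle[of u v x] dist_triangle[of x v y] by (simp add: dist_commute)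
      then show ?thesis using that e2 by linarith
    qed
    then show ?thesis by (fastforce simp: far_pairs_def)
  qed
  ultimately show False by (simp add: far_measure_def)
qed

section \<open>Reduction to Borel sets\<close>

text \<open>A Lebesgue measurable set contains a Borel set of full measure, and neither the measure nor the
  edge number notices the difference (see the lemmas below). This reduces everything to Borel sets.\<close>

lemma lebesgue_borel_core:
  fixes A :: "'a::euclidean_space set"
  assumes "A \<in> sets lebesgue"
  obtains B where "B \<in> sets borel" "B \<subseteq> A" "A - B \<in> null_sets lebesgue"
proof -
  obtain S N N' where S: "S \<in> sets lborel" "N' \<in> null_sets lborel" "N \<subseteq> N'" "A = S \<union> N"
    using assms by (auto elim: sets_completionE)
  have "A - S \<in> null_sets lebesgue"
    using S null_sets_completion_subset[of "A - S" N' lborel] null_sets_completionI[of N' lborel] by blast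
  then show ?thesis using that[of S] S by auto
qed

lemma null_sets_lebesgue_Times:
  fixes N :: "'a::euclidean_space set"
  assumes "N \<in> null_sets lebesgue"
  shows "N \<times> (UNIV :: 'b::euclidean_space set) \<in> null_sets lebesgue"
    and "(UNIV :: 'b set) \<times> N \<in> null_sets lebesgue"
proof -
  obtain N' where N': "N' \<in> null_sets lborel" "N \<subseteq> N'"
    using assms by (auto simp: null_sets_completion_iff2)
  then have b: "N' \<in> sets borel" by auto
  have "emeasure lborel (N' \<times> (UNIV :: 'b set)) = 0" "emeasure lborel ((UNIV :: 'b set) \<times> N') = 0"
    using lborel.emeasure_pair_measure_Times[of N' lborel "UNIV :: 'b set"]
      lborel.emeasure_pair_measure_Times[of "UNIV :: 'b set" lborel N'] N' b
    by (simp_all add: lborel_prod null_sets_def)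
  moreover have "N' \<times> (UNIV :: 'b set) \<in> sets borel" "(UNIV :: 'b set) \<times> N' \<in> sets borel"
    using b by (auto intro: borel_Times)
  ultimately have "N' \<times> (UNIV :: 'b set) \<in> null_sets lebesgue" "(UNIV :: 'b set) \<times> N' \<in> null_sets lebesgue"
    by (auto intro!: null_sets_completionI simp: null_sets_def[of lborel])
  then show "N \<times> (UNIV :: 'b set) \<in> null_sets lebesgue" "(UNIV :: 'b set) \<times> N \<in> null_sets lebesgue"
    using N'(2) null_sets_completion_subset by (metis Sigma_mono subset_refl)+
qed

lemma emeasure_lebesgue_core:
  assumes "A0 \<in> sets borel" "A0 \<subseteq> A" "A - A0 \<in> null_sets lebesgue"
  shows "emeasure lebesgue A = emeasure lborel A0"
proof -
  have "emeasure lebesgue (A0 \<union> (A - A0)) = emeasure lebesgue A0"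
    using assms by (intro emeasure_Un_null_set) auto
  then show ?thesis using assms by (simp add: Un_absorb1)
qed

lemma emeasure_large_distance_edges:
  fixes A A0 :: "(real ^ 'n) set"
  assumes A0: "A0 \<in> fmeasurable lborel" "A0 \<subseteq> A" "A - A0 \<in> null_sets lebesgue"
  shows "emeasure lebesgue (large_distance_edges A) = ennreal (far_measure A0 A0)"
proof -
  have eq: "large_distance_edges A = far_pairs A A"
    by (auto simp: large_distance_edges_def far_pairs_def dist_norm)
  have "far_pairs A A - far_pairs A0 A0 \<subseteq> (A - A0) \<times> UNIV \<union> UNIV \<times> (A - A0)"
    by (auto simp: far_pairs_def)
  moreover have "(A - A0) \<times> UNIV \<union> UNIV \<times> (A - A0) \<in> null_sets lebesgue"
    using null_sets_lebesgue_Times[OF A0(3)] by (rule null_sets.Un)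
  ultimately have "far_pairs A A - far_pairs A0 A0 \<in> null_sets lebesgue"
    using null_sets_completion_subset by blast
  then have "emeasure lebesgue (far_pairs A A) = emeasure lborel (far_pairs A0 A0)"
    using A0 by (intro emeasure_lebesgue_core far_pairs_borel fmeasurable_lborel_sets) (auto simp: far_pairs_def)
  also have "\<dots> = ennreal (far_measure A0 A0)"
    using far_pairs_fmeasurable[OF A0(1,1)] by (simp add: far_measure_def emeasure_eq_measure2)
  finally show ?thesis unfolding eq .
qed

text \<open>An honest clique \<open>f 1\<close>, ..., \<open>f k\<close> in the support would give a product of small balls about
  its vertices, intersected with \<open>A0\<close>, which has positive measure and consists of cliques of \<open>A\<close>.\<close>

lemma essentially_clique_free_ess_support:
  fixes A A0 :: "(real ^ 'n) set"
  assumes cf: "essentially_clique_free k A" and A0: "A0 \<in> sets borel" "A0 \<subseteq> A"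
  shows "clique_free k (ess_support A0)"
  unfolding clique_free_def
proof safe
  fix F assume F: "F \<subseteq> ess_support A0" "far_clique F" and k: "k = card F"
  interpret product_sigma_finite "\<lambda>_::nat. lborel :: (real ^ 'n) measure" ..
  let ?P = "Pi\<^sub>M {1..k} (\<lambda>_. lborel :: (real ^ 'n) measure)"
  obtain \<epsilon> where e: "\<epsilon> > 0" "\<And>x y x' y'. \<lbrakk>x \<in> F; y \<in> F; x \<noteq> y; dist x x' < \<epsilon>; dist y y' < \<epsilon>\<rbrakk> \<Longrightarrow> dist x' y' > 2"
    using far_clique_room[OF F(2)] by metis
  obtain f where f: "bij_betw f {1..k} F"
    using ex_bij_betw_nat_finite_1[of F] F(2) k by (auto simp: far_clique_def)
  define E where "E = (\<Pi>\<^sub>E i\<in>{1..k}. A0 \<inter> ball (f i) \<epsilon>)"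
  have fF: "f i \<in> F" if "i \<in> {1..k}" for i using f that by (auto simp: bij_betw_def)
  have "E \<subseteq> large_distance_cliques k A"
  proof
    fix p assume p: "p \<in> E"
    have pi: "p i \<in> A" "dist (f i) (p i) < \<epsilon>" if "i \<in> {1..k}" for i
      using p that A0(2) by (auto simp: E_def PiE_iff)
    have "dist (p i) (p j) > 2" if ij: "i \<in> {1..k}" "j \<in> {1..k}" "i \<noteq> j" for i j
    proof (rule e(2)[of "f i" "f j"])
      show "f i \<noteq> f j" using ij bij_betw_imp_inj_on[OF f] by (meson inj_on_contraD)
    qed (use fF pi ij in auto)
    then show "p \<in> large_distance_cliques k A"
      using pi p by (auto simp: large_distance_cliques_def large_distance_edges_def E_def PiE_iff dist_norm)
  qed
  then obtain N where N: "N \<in> null_sets ?P" "E \<subseteq> N"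
    using cf by (auto simp: essentially_clique_free_def null_sets_completion_iff2)
  have "emeasure ?P E \<le> emeasure ?P N" using N by (intro emeasure_mono) auto
  then have "emeasure ?P E = 0" using N(1) by (simp add: null_sets_def)
  moreover have "emeasure ?P E = (\<Prod>i\<in>{1..k}. emeasure lborel (A0 \<inter> ball (f i) \<epsilon>))"
    unfolding E_def using A0(1) by (intro emeasure_PiM) auto
  ultimately obtain i where "i \<in> {1..k}" "emeasure lborel (A0 \<inter> ball (f i) \<epsilon>) = 0"
    by (auto simp: prod_zero_iff)
  then show False using fF F(1) e(1) by (fastforce simp: ess_support_def)
qed

section \<open>Extremal decompositions\<close>

lemma turan_partition_fmeasurable:
  assumes "turan_partition m A B"
  shows "A \<in> fmeasurable lborel"
proof -
  have "(\<Union>i\<in>{1..m}. B i) \<in> fmeasurable lborel"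
    using assms unfolding turan_partition_def by (intro fmeasurable.finite_UN) auto
  then show ?thesis using assms unfolding turan_partition_def by metis
qed

text \<open>Intersecting each part with its support upgrades the conditions on almost all pairs to the
  distance conditions; the isodiametric inequality then bounds the common measure of the parts by that of the unit ball.\<close>

lemma extremal_decomposition_of_turan_partition:
  fixes A A1 :: "(real ^ 'n) set"
  assumes A1: "A1 \<subseteq> A" "A - A1 \<in> null_sets lebesgue"
    and P: "turan_partition (k - 1) A1 B" and k: "k \<ge> 2"
  shows "\<exists>c\<in>{0..unit_ball_vol (real CARD('n))}. extremal_decomposition k A c"
proof -
  define c where "c = measure lborel A1 / real (k - 1)"
  define B' where "B' i = B i \<inter> ess_support (B i)" for i
  have fm: "B i \<in> fmeasurable lborel" and c: "measure lborel (B i) = c"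
    and W0: "far_measure (B i) (B i) = 0" if "i \<in> {1..k-1}" for i
    using P that unfolding turan_partition_def c_def by blast+
  have W: "far_measure (B i) (B j) = measure lborel (B i) * measure lborel (B j)"
    if "i \<in> {1..k-1}" "j \<in> {1..k-1}" "i \<noteq> j" for i j
    using P that unfolding turan_partition_def by blast
  have U: "(\<Union>i\<in>{1..k-1}. B i) = A1" and dj: "disjoint_family_on B {1..k-1}"
    using P unfolding turan_partition_def by blast+
  have b: "B i \<in> sets borel" if "i \<in> {1..k-1}" for i
    using fm[OF that] by (rule fmeasurable_lborel_sets)
  have b': "B' i \<in> sets borel" if "i \<in> {1..k-1}" for i
    unfolding B'_def using b[OF that] closed_ess_support[OF b[OF that]] by auto
  have null: "B i - B' i \<in> null_sets lborel" if "i \<in> {1..k-1}" for i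
    using Diff_ess_support_null[OF b[OF that]] by (simp add: B'_def Diff_Int)
  have e': "emeasure lborel (B' i) = ennreal c" if "i \<in> {1..k-1}" for i
  proof -
    have "B' i = B i - (B i - B' i)" by (auto simp: B'_def)
    then have "emeasure lborel (B' i) = emeasure lborel (B i)"
      using emeasure_Diff_null_set[OF null[OF that], of "B i"] b[OF that] by simp
    then show ?thesis using fm[OF that] c[OF that] by (simp add: emeasure_eq_measure2)
  qed
  have near: "dist x y \<le> 2" if "i \<in> {1..k-1}" "x \<in> B' i" "y \<in> B' i" for i x y
    using ess_support_dist_le[OF fm fm W0] that by (simp add: B'_def)
  have 1: "1 \<in> {1..k-1}" using k by auto
  have c0: "0 \<le> c" unfolding c_def by simp
  have "ennreal c \<le> ennreal (unit_ball_vol (real CARD('n)))"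
    using isodiametric[OF b'[OF 1], of 1] near[OF 1] e'[OF 1] by simp
  then have cle: "c \<le> unit_ball_vol (real CARD('n))" by simp
  define N where "N = A - (\<Union>i\<in>{1..k-1}. B' i)"
  have "(\<Union>i\<in>{1..k-1}. B i - B' i) \<in> null_sets lborel"
    using null by (intro null_sets_UN') auto
  then have "(A - A1) \<union> (\<Union>i\<in>{1..k-1}. B i - B' i) \<in> null_sets lebesgue"
    using A1(2) null_sets_completionI by blast
  moreover have "N \<subseteq> (A - A1) \<union> (\<Union>i\<in>{1..k-1}. B i - B' i)"
    unfolding N_def U[symmetric] by blast
  ultimately have N: "N \<in> null_sets lebesgue"
    using null_sets_completion_subset by blast
  have "extremal_decomposition k A c"
    unfolding extremal_decomposition_def
  proof (intro exI[of _ N] exI[of _ B'] conjI ballI impI)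
    have "B' i \<subseteq> A" if "i \<in> {1..k-1}" for i
      using that A1(1) unfolding B'_def U[symmetric] by blast
    then show "A = N \<union> (\<Union>i\<in>{1..k-1}. B' i)" unfolding N_def by blast
    show "N \<inter> (\<Union>i\<in>{1..k-1}. B' i) = {}" unfolding N_def by blast
    show "disjoint_family_on B' {1..k-1}"
      using dj unfolding disjoint_family_on_def B'_def by blast
  next
    fix i j assume ij: "i \<in> {1..k-1}" "j \<in> {1..k-1}" "i \<noteq> j"
    have "2 \<le> dist x y" if "x \<in> B' i" "y \<in> B' j" for x y
      using ess_support_dist_ge[OF fm[OF ij(1)] fm[OF ij(2)] W[OF ij]] that by (simp add: B'_def)
    then show "2 \<le> set_distance (B' i) (B' j)"
      unfolding set_distance_def by (auto intro!: INF_greatest simp: dist_norm)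
  next
    fix i assume i: "i \<in> {1..k-1}"
    show "bounded (B' i)"
      unfolding bounded_two_points using near[OF i] by blast
    show "diameter (B' i) \<le> 2"
      using near[OF i] by (intro diameter_le) (auto simp: dist_norm)
    show "B' i \<in> sets lebesgue" using b'[OF i] by simp
    show "emeasure lebesgue (B' i) = ennreal c" using b'[OF i] e'[OF i] by simp
  qed (use N in simp)
  then show ?thesis using c0 cle by auto
qed

lemma turan_partition_of_extremal_decomposition:
  fixes A :: "(real ^ 'n) set"
  assumes E: "extremal_decomposition k A c" and "0 \<le> c" "k \<ge> 2"
  shows "\<exists>C B. C \<subseteq> A \<and> A - C \<in> null_sets lebesgue \<and> turan_partition (k - 1) C B"
proof -
  obtain N B where N: "N \<in> null_sets lebesgue" and A: "A = N \<union> (\<Union>i\<in>{1..k-1}. B i)"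
    and dj: "disjoint_family_on B {1..k-1}"
    and far: "\<forall>i\<in>{1..k-1}. \<forall>j\<in>{1..k-1}. i \<noteq> j \<longrightarrow> set_distance (B i) (B j) \<ge> 2"
    and B: "\<forall>i\<in>{1..k-1}. bounded (B i) \<and> diameter (B i) \<le> 2 \<and>
           B i \<in> sets lebesgue \<and> emeasure lebesgue (B i) = ennreal c"
    using E unfolding extremal_decomposition_def by blast
  have "\<forall>i\<in>{1..k-1}. \<exists>D. D \<in> sets borel \<and> D \<subseteq> B i \<and> B i - D \<in> null_sets lebesgue"
    using B lebesgue_borel_core by metis
  then obtain D where D: "\<And>i. i \<in> {1..k-1} \<Longrightarrow> D i \<in> sets borel"
      "\<And>i. i \<in> {1..k-1} \<Longrightarrow> D i \<subseteq> B i" "\<And>i. i \<in> {1..k-1} \<Longrightarrow> B i - D i \<in> null_sets lebesgue"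
    by metis
  have fm: "D i \<in> fmeasurable lborel" if "i \<in> {1..k-1}" for i
    using bounded_borel_fmeasurable[OF D(1)[OF that]] bounded_subset[OF _ D(2)[OF that]] B that by blast
  have c: "measure lborel (D i) = c" if "i \<in> {1..k-1}" for i
  proof -
    have "emeasure lborel (D i) = ennreal c"
      using emeasure_lebesgue_core[OF D[OF that]] B that by metis
    then show ?thesis using \<open>0 \<le> c\<close> by (simp add: measure_def)
  qed
  have djD: "disjoint_family_on D {1..k-1}"
    using dj D(2) unfolding disjoint_family_on_def by blast
  define C where "C = (\<Union>i\<in>{1..k-1}. D i)"
  have mC: "measure lborel C = real (k - 1) * c"
  proof -
    have "measure lborel C = (\<Sum>i\<in>{1..k-1}. measure lborel (D i))"
      unfolding C_def using fm djD D(1) by (intro measure_finite_Union) (auto simp: fmeasurableD2)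
    then show ?thesis using c by simp
  qed
  have "turan_partition (k - 1) C D"
    unfolding turan_partition_def
  proof (intro conjI ballI impI)
    fix i assume i: "i \<in> {1..k-1}"
    show "D i \<in> fmeasurable lborel" by (rule fm[OF i])
    show "measure lborel (D i) = measure lborel C / real (k - 1)"
      using c[OF i] mC \<open>k \<ge> 2\<close> by simp
    have Bi: "bounded (B i)" "diameter (B i) \<le> 2" using B i by blast+
    have "dist x y \<le> 2" if "x \<in> D i" "y \<in> D i" for x y
      by (rule order_trans[OF diameter_bounded_bound[OF Bi(1)] Bi(2)]) (use that D(2)[OF i] in auto)
    then have "far_pairs (D i) (D i) = {}" by (force simp: far_pairs_def)
    then show "far_measure (D i) (D i) = 0" by (simp add: far_measure_def)
  next
    fix i j assume ij: "i \<in> {1..k-1}" "j \<in> {1..k-1}" "i \<noteq> j"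
    show "far_measure (D i) (D j) = measure lborel (D i) * measure lborel (D j)"
    proof (rule far_measure_eq_product[OF fm[OF ij(1)] fm[OF ij(2)]])
      fix x y assume "x \<in> D i" "y \<in> D j"
      then have "(x, y) \<in> B i \<times> B j" using D(2) ij by blast
      then have "set_distance (B i) (B j) \<le> ereal (norm (x - y))"
        unfolding set_distance_def by (force intro: INF_lower2)
      moreover have "2 \<le> set_distance (B i) (B j)" using far ij by blast
      ultimately have "2 \<le> ereal (norm (x - y))" by (rule order_trans[rotated])
      then show "2 \<le> dist x y" by (simp add: dist_norm)
    qed
  qed (use djD C_def in auto)
  moreover have "C \<subseteq> A" using A D(2) unfolding C_def by blast
  moreover have "A - C \<in> null_sets lebesgue"
  proof -
    have "N \<union> (\<Union>i\<in>{1..k-1}. B i - D i) \<in> null_sets lebesgue"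
      using N D(3) by (intro null_sets.Un null_sets_UN') auto
    moreover have "A - C \<subseteq> N \<union> (\<Union>i\<in>{1..k-1}. B i - D i)" unfolding A C_def by blast
    ultimately show ?thesis using null_sets_completion_subset by blast
  qed
  ultimately show ?thesis by blast
qed

text \<open>Both sides of the inequality in terms of a measurable core \<open>C\<close> of \<open>A\<close>.\<close>

lemma large_distance_ennreal:
  fixes A C :: "(real ^ 'n) set"
  assumes C: "C \<in> fmeasurable lborel" "C \<subseteq> A" "A - C \<in> null_sets lebesgue" and k: "k \<ge> 2"
  shows "large_distance_edge_number A = ennreal (1 / 2 * far_measure C C)"
    and "ennreal (1 / 2 * (1 - 1 / (real k - 1))) * (emeasure lebesgue A)\<^sup>2
       = ennreal (1 / 2 * ((1 - 1 / real (k - 1)) * (measure lborel C)\<^sup>2))"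
proof -
  have "large_distance_edge_number A = ennreal (far_measure C C) / ennreal 2"
    unfolding large_distance_edge_number_def emeasure_large_distance_edges[OF C] by simp
  also have "\<dots> = ennreal (1 / 2 * far_measure C C)"
    by (subst divide_ennreal) auto
  finally show "large_distance_edge_number A = ennreal (1 / 2 * far_measure C C)" .
  have "emeasure lebesgue A = ennreal (measure lborel C)"
    using emeasure_lebesgue_core[OF fmeasurable_lborel_sets[OF C(1)] C(2,3)] C(1)
    by (simp add: emeasure_eq_measure2)
  moreover have "real k - 1 = real (k - 1)"
    using k by (simp add: of_nat_diff)
  moreover have "ennreal a * (ennreal n)\<^sup>2 = ennreal (a * n\<^sup>2)" if "0 \<le> n" for a n :: real
    using that by (simp add: ennreal_power ennreal_mult'')
  ultimately show "ennreal (1 / 2 * (1 - 1 / (real k - 1))) * (emeasure lebesgue A)\<^sup>2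
       = ennreal (1 / 2 * ((1 - 1 / real (k - 1)) * (measure lborel C)\<^sup>2))"
    by (simp only: measure_nonneg mult.assoc)
qed

theorem theorem1p4:
  fixes k :: nat and A :: "(real ^ 'n) set"
  assumes "k \<ge> 2"
    and "A \<in> sets lebesgue"
    and "essentially_clique_free k A"
  shows "large_distance_edge_number A
           \<le> ennreal (1 / 2 * (1 - 1 / (real k - 1))) * (emeasure lebesgue A)\<^sup>2 \<and>
         (large_distance_edge_number A
           = ennreal (1 / 2 * (1 - 1 / (real k - 1))) * (emeasure lebesgue A)\<^sup>2 \<longleftrightarrow>
         (\<exists>c \<in> {0..unit_ball_vol (real CARD('n))}. extremal_decomposition k A c))"
proof -
  define m where "m = k - 1"
  have m: "1 \<le> m" "k = Suc m" using assms(1) by (auto simp: m_def)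
  obtain A0 where A0: "A0 \<in> sets borel" "A0 \<subseteq> A" "A - A0 \<in> null_sets lebesgue"
    using lebesgue_borel_core[OF assms(2)] by blast
  \<comment> \<open>\<open>A1\<close> is free of \<open>k\<close>-cliques without exception and differs from \<open>A\<close> by a null set.\<close>
  define A1 where "A1 = A0 \<inter> ess_support A0"
  have A1: "A1 \<in> sets borel" "A1 \<subseteq> A"
    using A0 closed_ess_support[OF A0(1)] by (auto simp: A1_def)
  have "(A - A0) \<union> (A0 - ess_support A0) \<in> null_sets lebesgue"
    using A0(3) Diff_ess_support_null[OF A0(1)] null_sets_completionI by blast
  moreover have "A - A1 = (A - A0) \<union> (A0 - ess_support A0)" using A0(2) by (auto simp: A1_def)
  ultimately have null: "A - A1 \<in> null_sets lebesgue" by simp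
  have cf: "clique_free (Suc m) A1"
    using essentially_clique_free_ess_support[OF assms(3) A0(1,2)] m(2)
    by (auto simp: A1_def intro: clique_free_mono)
  have fm: "A1 \<in> fmeasurable lborel"
    by (rule bounded_borel_fmeasurable[OF A1(1) clique_free_bounded[OF cf]])
  note T = turan_far[OF m(1) A1(1) cf]
  note L = large_distance_ennreal[OF fm A1(2) null assms(1), folded m_def]
  have nn: "0 \<le> (1 - 1 / real m) * (measure lborel A1)\<^sup>2" using m by simp
  show ?thesis
  proof (intro conjI iffI)
    show "large_distance_edge_number A
        \<le> ennreal (1 / 2 * (1 - 1 / (real k - 1))) * (emeasure lebesgue A)\<^sup>2"
      unfolding L using T by (intro ennreal_leI) simp
  next
    assume "large_distance_edge_number A
        = ennreal (1 / 2 * (1 - 1 / (real k - 1))) * (emeasure lebesgue A)\<^sup>2"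
    then have "1 / 2 * far_measure A1 A1 = 1 / 2 * ((1 - 1 / real m) * (measure lborel A1)\<^sup>2)"
      unfolding L using nn by (subst (asm) ennreal_inj) auto
    then obtain B where "turan_partition (k - 1) A1 B" using T m_def by auto
    then show "\<exists>c \<in> {0..unit_ball_vol (real CARD('n))}. extremal_decomposition k A c"
      using extremal_decomposition_of_turan_partition[OF A1(2) null _ assms(1)] by blast
  next
    assume "\<exists>c \<in> {0..unit_ball_vol (real CARD('n))}. extremal_decomposition k A c"
    then obtain c where "extremal_decomposition k A c" "0 \<le> c" by auto
    then obtain C B where C: "C \<subseteq> A" "A - C \<in> null_sets lebesgue" "turan_partition m C B"
      using turan_partition_of_extremal_decomposition[OF _ _ assms(1)] unfolding m_def by metis
    have "C \<in> fmeasurable lborel"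
      by (rule turan_partition_fmeasurable[OF C(3)])
    note L' = large_distance_ennreal[OF this C(1,2) assms(1), folded m_def]
    show "large_distance_edge_number A
        = ennreal (1 / 2 * (1 - 1 / (real k - 1))) * (emeasure lebesgue A)\<^sup>2"
      unfolding L' turan_partition_far_measure[OF C(3) m(1)] ..
  qed
qed

end
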